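(* Let $(f_1,h_1),(f_2,h_2)\in C^\infty_E(M)\times C^\infty(M)$. Then the Lie bracket $[X_{(f_1,h_1)},X_{(f_2,h_2)}]$ of their pre-Hamiltonian lifts is the pre-Hamiltonian lift $X_{(f,h)}$ of a pair of functions $(f,h)\in C^\infty_E(M)\times C^\infty(M)$.
   Context: Everything is smooth. $M$ is a $(2n+1)$-dimensional manifold with a regular almost-cosymplectic-contact structure $(\omega,\Omega)$, i.e. a 1-form $\omega$ and a 2-form $\Omega$ with $d\Omega=0$ and $\omega\wedge\Omega^n$ nowhere zero. For a vector field $X$ put $\Omega^\flat(X)=i_X\Omega$. $(E,\Lambda)$ denotes the dual almost-coPoisson-Jacobi structure: the unique pair of a vector field $E$ and a skew-symmetric 2-vector field $\Lambda$ with $i_E\omega=1$, $i_E\Omega=0$, $i_\omega\Lambda=0$ and $(\Omega^\flat|_{\mathrm{Im}\,\Lambda^\sharp})^{-1}=\Lambda^\sharp|_{\mathrm{Im}\,\Omega^\flat}$, where $\Lambda^\sharp(\alpha)=\alpha^\sharp=i_\alpha\Lambda$ for a 1-form $\alpha$, i.e. $\beta(\alpha^\sharp)=\Lambda(\alpha,\beta)$. We write $df^\sharp=(df)^\sharp$, and $E\cdot f$ for the derivative of $f$ along $E$. The pre-Hamiltonian lift of a pair of functions $(f,h)$ is the vector field $X_{(f,h)}=df^\sharp+h\,E$. $C^\infty_E(M)$ is the sheaf of conserved functions, i.e. functions $f$ with $E\cdot f=0$. *)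

theory Defs
  imports "HOL-Analysis.Analysis" "HOL-Combinatorics.Permutations"
begin

section \<open>Smooth manifolds\<close>

text \<open>Only used for open \<open>S\<close>, so that \<open>frechet_derivative f (at x)\<close> depends on \<open>f\<close> on \<open>S\<close> only.
  The domain is finite-dimensional, hence continuity of all iterated directional derivatives
  is the usual notion of class \<open>C\<^sup>k\<close>.\<close>

primrec Ck_on :: "nat \<Rightarrow> 'e::euclidean_space set \<Rightarrow> ('e \<Rightarrow> 'f::real_normed_vector) \<Rightarrow> bool" where
  "Ck_on 0 S f = continuous_on S f"
| "Ck_on (Suc k) S f \<longleftrightarrow>
     (\<forall>x\<in>S. f differentiable (at x)) \<and> (\<forall>v. Ck_on k S (\<lambda>x. frechet_derivative f (at x) v))"

definition smooth_on :: "'e::euclidean_space set \<Rightarrow> ('e \<Rightarrow> 'f::real_normed_vector) \<Rightarrow> bool" where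
  "smooth_on S f \<longleftrightarrow> (\<forall>k. Ck_on k S f)"

text \<open>A chart is a pair of its domain and its coordinate map; the values of the coordinate map
  outside of the domain are irrelevant.\<close>

type_synonym ('m, 'e) chart = "'m set \<times> ('m \<Rightarrow> 'e)"

abbreviation chart_dom :: "('m, 'e) chart \<Rightarrow> 'm set" where "chart_dom \<equiv> fst"
abbreviation coord :: "('m, 'e) chart \<Rightarrow> 'm \<Rightarrow> 'e" where "coord \<equiv> snd"

definition chart_inv :: "('m, 'e) chart \<Rightarrow> 'e \<Rightarrow> 'm" where
  "chart_inv c = inv_into (chart_dom c) (coord c)"

definition is_chart :: "('m::topological_space, 'e::euclidean_space) chart \<Rightarrow> bool" where
  "is_chart c \<longleftrightarrow> open (chart_dom c) \<and> open (coord c ` chart_dom c) \<and>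
     homeomorphism (chart_dom c) (coord c ` chart_dom c) (coord c) (chart_inv c)"

definition in_chart :: "('m, 'e) chart \<Rightarrow> ('m \<Rightarrow> 'b) \<Rightarrow> 'e \<Rightarrow> 'b" where
  "in_chart c F = (\<lambda>x. F (chart_inv c x))"

definition smooth_in :: "('m, 'e::euclidean_space) chart \<Rightarrow> ('m \<Rightarrow> 'f::real_normed_vector) \<Rightarrow> bool" where
  "smooth_in c F \<longleftrightarrow> smooth_on (coord c ` chart_dom c) (in_chart c F)"

definition chart_deriv ::
  "('m, 'e::euclidean_space) chart \<Rightarrow> ('m \<Rightarrow> 'f::real_normed_vector) \<Rightarrow> 'm \<Rightarrow> 'e \<Rightarrow>\<^sub>L 'f" where
  "chart_deriv c F p = Blinfun (frechet_derivative (in_chart c F) (at (coord c p)))"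

text \<open>The manifold is the whole type \<open>'m\<close>; its dimension is \<open>DIM('e)\<close>.\<close>

definition smooth_manifold ::
  "('m::{t2_space, second_countable_topology}, 'e::euclidean_space) chart set \<Rightarrow> bool" where
  "smooth_manifold A \<longleftrightarrow>
     (\<forall>c\<in>A. is_chart c) \<and> (\<Union>c\<in>A. chart_dom c) = UNIV \<and>
     (\<forall>c\<in>A. \<forall>d\<in>A. smooth_on (coord c ` (chart_dom c \<inter> chart_dom d)) (in_chart c (coord d)))"

definition smooth_fun :: "('m, 'e::euclidean_space) chart set \<Rightarrow> ('m \<Rightarrow> real) \<Rightarrow> bool" where
  "smooth_fun A f \<longleftrightarrow> (\<forall>c\<in>A. smooth_in c f)"

section \<open>Tensor fields\<close>

text \<open>A tensor field is the family of its local representations: \<open>T c p\<close> is the value at \<open>p\<close>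
  with respect to the chart \<open>c\<close>, which identifies the tangent space at \<open>p\<close> with \<open>'e\<close> and the
  cotangent space with \<open>'e \<Rightarrow>\<^sub>L real\<close>. The members of the family transform by the
  Jacobians \<open>chart_deriv c (coord d) p\<close> of the coordinate changes. The values for
  \<open>c \<notin> A\<close> or \<open>p \<notin> chart_dom c\<close> are irrelevant.\<close>

type_synonym ('m, 'e) vector_field = "('m, 'e) chart \<Rightarrow> 'm \<Rightarrow> 'e"
type_synonym ('m, 'e) one_form = "('m, 'e) chart \<Rightarrow> 'm \<Rightarrow> 'e \<Rightarrow>\<^sub>L real"
type_synonym ('m, 'e) two_form = "('m, 'e) chart \<Rightarrow> 'm \<Rightarrow> 'e \<Rightarrow>\<^sub>L 'e \<Rightarrow>\<^sub>L real"
type_synonym ('m, 'e) two_vector_field =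
  "('m, 'e) chart \<Rightarrow> 'm \<Rightarrow> ('e \<Rightarrow>\<^sub>L real) \<Rightarrow>\<^sub>L ('e \<Rightarrow>\<^sub>L real) \<Rightarrow>\<^sub>L real"

definition is_vector_field ::
  "('m, 'e::euclidean_space) chart set \<Rightarrow> ('m, 'e) vector_field \<Rightarrow> bool" where
  "is_vector_field A X \<longleftrightarrow> (\<forall>c\<in>A. smooth_in c (X c)) \<and>
     (\<forall>c\<in>A. \<forall>d\<in>A. \<forall>p \<in> chart_dom c \<inter> chart_dom d. X d p = chart_deriv c (coord d) p (X c p))"

definition is_one_form ::
  "('m, 'e::euclidean_space) chart set \<Rightarrow> ('m, 'e) one_form \<Rightarrow> bool" where
  "is_one_form A \<omega> \<longleftrightarrow> (\<forall>c\<in>A. smooth_in c (\<omega> c)) \<and>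
     (\<forall>c\<in>A. \<forall>d\<in>A. \<forall>p \<in> chart_dom c \<inter> chart_dom d.
        \<omega> c p = \<omega> d p o\<^sub>L chart_deriv c (coord d) p)"

definition is_two_form ::
  "('m, 'e::euclidean_space) chart set \<Rightarrow> ('m, 'e) two_form \<Rightarrow> bool" where
  "is_two_form A \<Omega> \<longleftrightarrow> (\<forall>c\<in>A. smooth_in c (\<Omega> c)) \<and>
     (\<forall>c\<in>A. \<forall>p\<in>chart_dom c. \<forall>u v. \<Omega> c p u v = - \<Omega> c p v u) \<and>
     (\<forall>c\<in>A. \<forall>d\<in>A. \<forall>p \<in> chart_dom c \<inter> chart_dom d. \<forall>u v.
        \<Omega> c p u v = \<Omega> d p (chart_deriv c (coord d) p u) (chart_deriv c (coord d) p v))"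

definition is_two_vector_field ::
  "('m, 'e::euclidean_space) chart set \<Rightarrow> ('m, 'e) two_vector_field \<Rightarrow> bool" where
  "is_two_vector_field A \<Lambda> \<longleftrightarrow> (\<forall>c\<in>A. smooth_in c (\<Lambda> c)) \<and>
     (\<forall>c\<in>A. \<forall>p\<in>chart_dom c. \<forall>\<alpha> \<beta> :: 'e \<Rightarrow>\<^sub>L real. \<Lambda> c p \<alpha> \<beta> = - \<Lambda> c p \<beta> \<alpha>) \<and>
     (\<forall>c\<in>A. \<forall>d\<in>A. \<forall>p \<in> chart_dom c \<inter> chart_dom d. \<forall>\<alpha> \<beta> :: 'e \<Rightarrow>\<^sub>L real.
        \<Lambda> d p \<alpha> \<beta> =
          \<Lambda> c p (\<alpha> o\<^sub>L chart_deriv c (coord d) p) (\<beta> o\<^sub>L chart_deriv c (coord d) p))"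

definition differential ::
  "('m \<Rightarrow> real) \<Rightarrow> ('m, 'e::euclidean_space) one_form" where
  "differential f c p = chart_deriv c f p"

text \<open>In coordinates, \<open>[X, Y]\<^sup>i = X\<^sup>j \<partial>\<^sub>j Y\<^sup>i - Y\<^sup>j \<partial>\<^sub>j X\<^sup>i\<close>.\<close>

definition lie_bracket ::
  "('m, 'e::euclidean_space) vector_field \<Rightarrow> ('m, 'e) vector_field \<Rightarrow> ('m, 'e) vector_field" where
  "lie_bracket X Y c p = chart_deriv c (Y c) p (X c p) - chart_deriv c (X c) p (Y c p)"

text \<open>In coordinates, \<open>(d\<Omega>)\<^sub>i\<^sub>j\<^sub>k = \<partial>\<^sub>i \<Omega>\<^sub>j\<^sub>k + \<partial>\<^sub>j \<Omega>\<^sub>k\<^sub>i + \<partial>\<^sub>k \<Omega>\<^sub>i\<^sub>j\<close>.\<close>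

definition ext_deriv2 ::
  "('m, 'e::euclidean_space) two_form \<Rightarrow> ('m, 'e) chart \<Rightarrow> 'm \<Rightarrow> 'e \<Rightarrow> 'e \<Rightarrow> 'e \<Rightarrow> real" where
  "ext_deriv2 \<Omega> c p u v w =
     chart_deriv c (\<lambda>q. \<Omega> c q v w) p u
   + chart_deriv c (\<lambda>q. \<Omega> c q w u) p v
   + chart_deriv c (\<lambda>q. \<Omega> c q u v) p w"

text \<open>Alternating \<open>k\<close>-linear forms on \<open>'e\<close> are represented as functions of sequences of vectors
  that depend on the entries \<open>0, \<dots>, k - 1\<close> only.\<close>

definition wedge ::
  "nat \<Rightarrow> nat \<Rightarrow> ((nat \<Rightarrow> 'e) \<Rightarrow> real) \<Rightarrow> ((nat \<Rightarrow> 'e) \<Rightarrow> real) \<Rightarrow> (nat \<Rightarrow> 'e) \<Rightarrow> real" where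
  "wedge k l a b v =
     (\<Sum>\<sigma> | \<sigma> permutes {..<k + l}.
        of_int (sign \<sigma>) * a (\<lambda>i. v (\<sigma> i)) * b (\<lambda>i. v (\<sigma> (k + i)))) / (fact k * fact l)"

primrec two_form_power ::
  "('e::euclidean_space \<Rightarrow>\<^sub>L 'e \<Rightarrow>\<^sub>L real) \<Rightarrow> nat \<Rightarrow> (nat \<Rightarrow> 'e) \<Rightarrow> real" where
  "two_form_power B 0 = (\<lambda>v. 1)"
| "two_form_power B (Suc n) = wedge 2 (2 * n) (\<lambda>v. B (v 0) (v 1)) (two_form_power B n)"

section \<open>Almost-cosymplectic-contact structures and their duals\<close>

definition regular_almost_cosymplectic_contact ::
  "('m, 'e::euclidean_space) chart set \<Rightarrow> nat \<Rightarrow> ('m, 'e) one_form \<Rightarrow> ('m, 'e) two_form \<Rightarrow> bool" where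
  "regular_almost_cosymplectic_contact A n \<omega> \<Omega> \<longleftrightarrow>
     is_one_form A \<omega> \<and> is_two_form A \<Omega> \<and>
     (\<forall>c\<in>A. \<forall>p\<in>chart_dom c. \<forall>u v w. ext_deriv2 \<Omega> c p u v w = 0) \<and>
     (\<forall>c\<in>A. \<forall>p\<in>chart_dom c.
        \<exists>v. wedge 1 (2 * n) (\<lambda>v. \<omega> c p (v 0)) (two_form_power (\<Omega> c p) n) v \<noteq> 0)"

definition flat ::
  "('m, 'e::euclidean_space) two_form \<Rightarrow> ('m, 'e) chart \<Rightarrow> 'm \<Rightarrow> 'e \<Rightarrow> 'e \<Rightarrow>\<^sub>L real" where
  "flat \<Omega> c p X = \<Omega> c p X"

text \<open>\<open>'e\<close> is finite-dimensional, so the vector \<open>\<alpha>\<^sup>\<sharp>\<close> exists and is unique.\<close>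

definition sharp ::
  "('m, 'e::euclidean_space) two_vector_field \<Rightarrow> ('m, 'e) chart \<Rightarrow> 'm \<Rightarrow> ('e \<Rightarrow>\<^sub>L real) \<Rightarrow> 'e" where
  "sharp \<Lambda> c p \<alpha> = (THE v. \<forall>\<beta>::'e \<Rightarrow>\<^sub>L real. blinfun_apply \<beta> v = \<Lambda> c p \<alpha> \<beta>)"

definition dual_almost_coPoisson_Jacobi ::
  "('m, 'e::euclidean_space) chart set \<Rightarrow> ('m, 'e) one_form \<Rightarrow> ('m, 'e) two_form \<Rightarrow>
   ('m, 'e) vector_field \<Rightarrow> ('m, 'e) two_vector_field \<Rightarrow> bool" where
  "dual_almost_coPoisson_Jacobi A \<omega> \<Omega> E \<Lambda> \<longleftrightarrow>
     is_vector_field A E \<and> is_two_vector_field A \<Lambda> \<and>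
     (\<forall>c\<in>A. \<forall>p\<in>chart_dom c.
        \<omega> c p (E c p) = 1 \<and> flat \<Omega> c p (E c p) = 0 \<and> sharp \<Lambda> c p (\<omega> c p) = 0 \<and>
        bij_betw (flat \<Omega> c p) (range (sharp \<Lambda> c p)) (range (flat \<Omega> c p)) \<and>
        (\<forall>\<alpha> \<in> range (flat \<Omega> c p).
           the_inv_into (range (sharp \<Lambda> c p)) (flat \<Omega> c p) \<alpha> = sharp \<Lambda> c p \<alpha>))"

definition conserved ::
  "('m, 'e::euclidean_space) chart set \<Rightarrow> ('m, 'e) vector_field \<Rightarrow> ('m \<Rightarrow> real) set" where
  "conserved A E =
     {f. smooth_fun A f \<and> (\<forall>c\<in>A. \<forall>p\<in>chart_dom c. differential f c p (E c p) = 0)}"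

definition pre_hamiltonian_lift ::
  "('m, 'e::euclidean_space) vector_field \<Rightarrow> ('m, 'e) two_vector_field \<Rightarrow>
   ('m \<Rightarrow> real) \<Rightarrow> ('m \<Rightarrow> real) \<Rightarrow> ('m, 'e) vector_field" where
  "pre_hamiltonian_lift E \<Lambda> f h c p = sharp \<Lambda> c p (differential f c p) + h p *\<^sub>R E c p"

end

theory Submission
  imports Defs
begin

text \<open>Write \<open>X\<close> and \<open>Y\<close> for the two lifts. The volume condition says that \<open>\<Omega>\<close> and \<open>\<omega>\<close> have no common
  kernel (\<open>volume_form_nondegenerate\<close>). Hence the kernel of \<open>\<Omega>\<^sup>\<flat>\<close> is spanned by \<open>E\<close> and its image
  consists of all covectors that vanish at \<open>E\<close> (\<open>kernel_two_form\<close>, \<open>range_two_form\<close>). For a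
  conserved function \<open>f\<^sub>1\<close>, the differential \<open>df\<^sub>1\<close> is such a covector, and since \<open>\<sharp>\<close> inverts \<open>\<Omega>\<^sup>\<flat>\<close>
  there, \<open>i\<^bsub>X\<^esub> \<Omega> = df\<^sub>1\<close>; likewise \<open>i\<^bsub>Y\<^esub> \<Omega> = df\<^sub>2\<close>.

  As \<open>\<Omega>\<close> is closed, \<open>L\<^bsub>X\<^esub> \<Omega> = d (i\<^bsub>X\<^esub> \<Omega>) = 0\<close> and therefore
  \<open>i\<^bsub>[X,Y]\<^esub> \<Omega> = L\<^bsub>X\<^esub> (i\<^bsub>Y\<^esub> \<Omega>) = d (X \<cdot> f\<^sub>2)\<close> (\<open>interior_product_bracket\<close>). Put \<open>f = X \<cdot> f\<^sub>2\<close>. Then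
  \<open>E \<cdot> f = \<Omega> ([X,Y], E) = 0\<close>, so \<open>f\<close> is conserved, and \<open>df\<^sup>\<sharp>\<close> and \<open>[X,Y]\<close> have the same image under
  \<open>\<Omega>\<^sup>\<flat>\<close>. They differ by a multiple of \<open>E\<close>, and the factor is \<open>h = \<omega> ([X,Y])\<close> because \<open>\<omega>\<close> vanishes on
  the image of \<open>\<sharp>\<close>.

  The computation takes place in a single chart. For \<open>f\<close> and \<open>h\<close> to be functions on the manifold,
  lifts and brackets have to be vector fields, that is, transform by the Jacobians of the coordinate
  changes (\<open>is_vector_field_pre_hamiltonian_lift\<close>, \<open>is_vector_field_lie_bracket\<close>). Both this and the
  computation rest on the symmetry of second derivatives (\<open>second_derivative_symmetric_real\<close>).\<close>

section \<open>Smooth maps on open sets\<close>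

text \<open>Keeping the derivative bundled as a \<open>blinfun\<close>, as \<^const>\<open>chart_deriv\<close> does, makes it
  a map into a normed space that can be differentiated again.\<close>

definition total_deriv :: "('e::euclidean_space \<Rightarrow> 'f::real_normed_vector) \<Rightarrow> 'e \<Rightarrow> 'e \<Rightarrow>\<^sub>L 'f" where
  "total_deriv f x = Blinfun (frechet_derivative f (at x))"

lemma total_deriv_apply:
  assumes "f differentiable (at x)"
  shows "blinfun_apply (total_deriv f x) = frechet_derivative f (at x)"
  using assms unfolding total_deriv_def
  by (intro bounded_linear_Blinfun_apply)
    (simp add: frechet_derivative_works has_derivative_bounded_linear)

lemma has_derivative_total_deriv:
  assumes "f differentiable (at x)"
  shows "(f has_derivative total_deriv f x) (at x)"
  using assms by (simp add: total_deriv_apply flip: frechet_derivative_works)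

lemma total_deriv_unique:
  assumes "(f has_derivative f') (at x)"
  shows "blinfun_apply (total_deriv f x) = f'"
proof -
  have "f differentiable (at x)"
    using assms by (auto simp: differentiable_def)
  then show ?thesis
    using assms by (simp add: total_deriv_apply frechet_derivative_at[symmetric])
qed

lemma Ck_on_Suc_imp: "Ck_on (Suc k) S f \<Longrightarrow> Ck_on k S f"
proof (induction k arbitrary: f)
  case 0
  then show ?case
    by (simp add: differentiable_imp_continuous_on differentiable_on_def differentiable_at_withinI)
next
  case (Suc k)
  then have "Ck_on k S (\<lambda>x. frechet_derivative f (at x) v)" for v
    by (metis Ck_on.simps(2))
  with Suc.prems show ?case
    by simp
qed

text \<open>Openness of \<open>S\<close> is essential: only then do the values on \<open>S\<close> determine the Frechet
  derivatives at the points of \<open>S\<close>.\<close>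

lemma Ck_on_cong:
  assumes "open S" and "\<And>x. x \<in> S \<Longrightarrow> f x = g x" and "Ck_on k S g"
  shows "Ck_on k S f"
  using assms(2-)
proof (induction k arbitrary: f g)
  case 0
  then show ?case
    by (simp cong: continuous_on_cong)
next
  case (Suc k)
  have D: "(f has_derivative frechet_derivative g (at x)) (at x)" if "x \<in> S" for x
    using Suc.prems that frechet_derivative_works
    by (metis Ck_on.simps(2) has_derivative_transform_within_open[OF _ \<open>open S\<close>])
  have "frechet_derivative f (at x) = frechet_derivative g (at x)" if "x \<in> S" for x
    using frechet_derivative_at[OF D[OF that]] by simp
  moreover have "f differentiable (at x)" if "x \<in> S" for x
    using D[OF that] by (auto simp: differentiable_def)
  ultimately show ?case
    using Suc by auto
qed

lemma Ck_on_const: "Ck_on k S (\<lambda>x. y)"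
  by (induction k arbitrary: y) simp_all

lemma Ck_on_SucI:
  assumes "open S"
    and "\<And>x. x \<in> S \<Longrightarrow> (f has_derivative f' x) (at x)"
    and "\<And>v. Ck_on k S (\<lambda>x. f' x v)"
  shows "Ck_on (Suc k) S f"
proof -
  have "Ck_on k S (\<lambda>x. frechet_derivative f (at x) v)" for v
    by (rule Ck_on_cong[OF assms(1) _ assms(3)]) (simp add: frechet_derivative_at[OF assms(2), symmetric])
  moreover have "\<forall>x\<in>S. f differentiable (at x)"
    using assms(2) unfolding differentiable_def by blast
  ultimately show ?thesis
    by simp
qed

lemma Ck_on_SucD:
  assumes "Ck_on (Suc k) S f"
  shows "x \<in> S \<Longrightarrow> (f has_derivative frechet_derivative f (at x)) (at x)"
    and "Ck_on k S (\<lambda>x. frechet_derivative f (at x) v)"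
  using assms by (simp_all flip: frechet_derivative_works)

lemma Ck_on_add:
  assumes "open S" and "Ck_on k S f" and "Ck_on k S g"
  shows "Ck_on k S (\<lambda>x. f x + g x)"
  using assms(2-)
proof (induction k arbitrary: f g)
  case 0
  then show ?case
    by (simp add: continuous_on_add)
next
  case (Suc k)
  show ?case
  proof (rule Ck_on_SucI[OF assms(1)])
    show "Ck_on k S (\<lambda>x. frechet_derivative f (at x) v + frechet_derivative g (at x) v)" for v
      using Suc.prems[THEN Ck_on_SucD(2)] by (rule Suc.IH)
  qed (rule has_derivative_add; rule Suc.prems[THEN Ck_on_SucD(1)])
qed

lemma Ck_on_bounded_linear:
  assumes "open S" and "bounded_linear L" and "Ck_on k S f"
  shows "Ck_on k S (\<lambda>x. L (f x))"
  using assms(3-)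
proof (induction k arbitrary: f)
  case 0
  then show ?case
    by (simp add: bounded_linear.continuous_on[OF assms(2)])
next
  case (Suc k)
  show ?case
  proof (rule Ck_on_SucI[OF assms(1)])
    show "Ck_on k S (\<lambda>x. L (frechet_derivative f (at x) v))" for v
      using Ck_on_SucD(2)[OF Suc.prems] by (rule Suc.IH)
  qed (rule bounded_linear.has_derivative[OF assms(2) Ck_on_SucD(1)[OF Suc.prems]])
qed

text \<open>By the product rule, the directional derivative of a product is a sum of two products of
  functions that are still of class \<open>C\<^sup>k\<close>; this is why the factors vary in the induction.\<close>

lemma Ck_on_bounded_bilinear:
  assumes "open S" and "bounded_bilinear B" and "Ck_on k S f" and "Ck_on k S g"
  shows "Ck_on k S (\<lambda>x. B (f x) (g x))"
  using assms(3-)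
proof (induction k arbitrary: f g)
  case 0
  then show ?case
    by (simp add: bounded_bilinear.continuous_on[OF assms(2)])
next
  case (Suc k)
  note D = Suc.prems[THEN Ck_on_SucD(1)] Suc.prems[THEN Ck_on_SucD(2)]
  have "Ck_on k S (\<lambda>x. B (f x) (frechet_derivative g (at x) v) + B (frechet_derivative f (at x) v) (g x))"
    for v
    by (rule Ck_on_add[OF assms(1)]; rule Suc.IH; (rule D | rule Ck_on_Suc_imp, rule Suc.prems))
  then show ?case
    by (rule Ck_on_SucI[OF assms(1), rotated]) (rule bounded_bilinear.FDERIV[OF assms(2)]; rule D(1,2))
qed

lemma smooth_on_differentiable: "smooth_on S f \<Longrightarrow> x \<in> S \<Longrightarrow> f differentiable (at x)"
  unfolding smooth_on_def by (metis Ck_on.simps(2))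

lemma smooth_on_directional_derivative:
  "smooth_on S f \<Longrightarrow> smooth_on S (\<lambda>x. frechet_derivative f (at x) v)"
  unfolding smooth_on_def by (metis Ck_on.simps(2))

lemma smooth_on_continuous: "smooth_on S f \<Longrightarrow> continuous_on S f"
  unfolding smooth_on_def by (metis Ck_on.simps(1))

lemma smooth_on_cong:
  "open S \<Longrightarrow> (\<And>x. x \<in> S \<Longrightarrow> f x = g x) \<Longrightarrow> smooth_on S g \<Longrightarrow> smooth_on S f"
  unfolding smooth_on_def by (metis Ck_on_cong)

lemma smooth_on_add:
  "open S \<Longrightarrow> smooth_on S f \<Longrightarrow> smooth_on S g \<Longrightarrow> smooth_on S (\<lambda>x. f x + g x)"
  unfolding smooth_on_def by (metis Ck_on_add)

lemma smooth_on_bounded_linear: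
  "open S \<Longrightarrow> bounded_linear L \<Longrightarrow> smooth_on S f \<Longrightarrow> smooth_on S (\<lambda>x. L (f x))"
  unfolding smooth_on_def by (metis Ck_on_bounded_linear)

lemma smooth_on_bounded_bilinear:
  "open S \<Longrightarrow> bounded_bilinear B \<Longrightarrow> smooth_on S f \<Longrightarrow> smooth_on S g \<Longrightarrow> smooth_on S (\<lambda>x. B (f x) (g x))"
  unfolding smooth_on_def by (metis Ck_on_bounded_bilinear)

lemma smooth_on_diff:
  "open S \<Longrightarrow> smooth_on S f \<Longrightarrow> smooth_on S g \<Longrightarrow> smooth_on S (\<lambda>x. f x - g x)"
  using smooth_on_add[of S f "\<lambda>x. - g x"] smooth_on_bounded_linear[of S uminus g]
  by (simp add: bounded_linear_minus)

lemma smooth_on_sum: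
  assumes "open S" and "\<And>i. i \<in> I \<Longrightarrow> smooth_on S (f i)"
  shows "smooth_on S (\<lambda>x. \<Sum>i\<in>I. f i x)"
proof -
  have "smooth_on S (\<lambda>x. 0)"
    by (simp add: smooth_on_def Ck_on_const)
  then show ?thesis
    using assms(2) by (induction I rule: infinite_finite_induct) (auto intro: smooth_on_add[OF assms(1)])
qed

text \<open>Smoothness is a matter of the finitely many values on a basis, since
  \<open>F x = (\<Sum>b\<in>Basis. (\<lambda>v. (v \<bullet> b) *\<^sub>R F x b))\<close> depends on them by bounded linear maps. This
  reduces smoothness of the total derivative to that of the directional derivatives.\<close>

lemma smooth_on_blinfun_components:
  fixes F :: "'a::euclidean_space \<Rightarrow> 'e::euclidean_space \<Rightarrow>\<^sub>L 'f::real_normed_vector"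
  assumes "open S" and "\<And>b. b \<in> Basis \<Longrightarrow> smooth_on S (\<lambda>x. F x b)"
  shows "smooth_on S F"
proof -
  let ?B = "\<lambda>b y. blinfun_scaleR_left y o\<^sub>L blinfun_inner_left b"
  have eq: "F x = (\<Sum>b\<in>Basis. ?B b (F x b))" for x
  proof (rule blinfun_eqI)
    fix u
    have "F x u = F x (\<Sum>b\<in>Basis. (u \<bullet> b) *\<^sub>R b)"
      by (simp add: euclidean_representation)
    then show "F x u = (\<Sum>b\<in>Basis. ?B b (F x b)) u"
      by (simp add: blinfun.sum_left blinfun.sum_right blinfun.scaleR_right inner_commute)
  qed
  have "bounded_linear (?B b)" for b :: 'e
    by (intro bounded_linear_intros)
  then have "smooth_on S (\<lambda>x. \<Sum>b\<in>Basis. ?B b (F x b))"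
    by (rule smooth_on_sum[OF assms(1) smooth_on_bounded_linear[OF assms(1) _ assms(2)]])
  then show ?thesis
    by (simp flip: eq)
qed

lemma smooth_on_total_deriv:
  assumes "open S" and "smooth_on S f"
  shows "smooth_on S (total_deriv f)"
proof (rule smooth_on_blinfun_components[OF assms(1)])
  fix b
  show "smooth_on S (\<lambda>x. total_deriv f x b)"
    using smooth_on_directional_derivative[OF assms(2)]
    by (rule smooth_on_cong[OF assms(1), rotated])
      (simp add: total_deriv_apply smooth_on_differentiable[OF assms(2)])
qed

section \<open>Symmetry of second derivatives\<close>

text \<open>The mean value theorem is applied to the second difference first in the direction \<open>u\<close> and
  then in the direction \<open>v\<close>.\<close>

lemma second_difference_mean_value:
  fixes f :: "'e::real_normed_vector \<Rightarrow> real"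
  assumes f: "\<And>y. y \<in> S \<Longrightarrow> (f has_derivative f' y) (at y)"
    and f': "\<And>y. y \<in> S \<Longrightarrow> ((\<lambda>y. f' y u) has_derivative f'' y) (at y)"
    and "s > 0"
    and S: "\<And>a b. \<lbrakk>0 \<le> a; a \<le> s; 0 \<le> b; b \<le> s\<rbrakk> \<Longrightarrow> x + a *\<^sub>R u + b *\<^sub>R v \<in> S"
  obtains a b where "0 < a" "a < s" "0 < b" "b < s"
    "f (x + s *\<^sub>R u + s *\<^sub>R v) - f (x + s *\<^sub>R u) - f (x + s *\<^sub>R v) + f x
      = s * s * f'' (x + a *\<^sub>R u + b *\<^sub>R v) v"
proof -
  define g where "g a = f (x + a *\<^sub>R u + s *\<^sub>R v) - f (x + a *\<^sub>R u)" for a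
  have lin: "linear (f' y)" if "y \<in> S" for y
    using f[OF that] has_derivative_linear by blast
  have lin': "linear (f'' y)" if "y \<in> S" for y
    using f'[OF that] has_derivative_linear by blast
  have S0: "x + a *\<^sub>R u \<in> S" if "0 \<le> a" "a \<le> s" for a
    using S[OF that, of 0] \<open>s > 0\<close> by simp
  have D: "((\<lambda>a. f (z + a *\<^sub>R u)) has_real_derivative f' (z + a *\<^sub>R u) u) (at a)"
    if "z + a *\<^sub>R u \<in> S" for z a
  proof -
    have "((\<lambda>a. f (z + a *\<^sub>R u)) has_derivative (\<lambda>t. f' (z + a *\<^sub>R u) (t *\<^sub>R u))) (at a)"
      by (rule has_derivative_compose[where f = "\<lambda>a. z + a *\<^sub>R u" and g = f, OF _ f[OF that]]) (auto intro!: derivative_eq_intros)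
    then show ?thesis
      by (simp add: has_field_derivative_def linear_scale[OF lin[OF that]] mult_commute_abs)
  qed
  have "(g has_real_derivative f' (x + a *\<^sub>R u + s *\<^sub>R v) u - f' (x + a *\<^sub>R u) u) (at a)"
    if "0 \<le> a" "a \<le> s" for a
    using DERIV_diff[OF D[of "x + s *\<^sub>R v" a] D[of x a]] S[OF that, of s] S0[OF that] \<open>s > 0\<close>
    unfolding g_def by (simp add: algebra_simps)
  from MVT2[OF \<open>s > 0\<close> this] obtain a where a: "0 < a" "a < s"
    and ga: "g s - g 0 = s * (f' (x + a *\<^sub>R u + s *\<^sub>R v) u - f' (x + a *\<^sub>R u) u)"
    by auto
  have D': "((\<lambda>b. f' (x + a *\<^sub>R u + b *\<^sub>R v) u) has_real_derivative
      f'' (x + a *\<^sub>R u + b *\<^sub>R v) v) (at b)" if "0 \<le> b" "b \<le> s" for b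
  proof -
    have mem: "x + a *\<^sub>R u + b *\<^sub>R v \<in> S"
      using a that by (intro S) auto
    have "((\<lambda>b. f' (x + a *\<^sub>R u + b *\<^sub>R v) u) has_derivative
        (\<lambda>t. f'' (x + a *\<^sub>R u + b *\<^sub>R v) (t *\<^sub>R v))) (at b)"
      by (rule has_derivative_compose[where f = "\<lambda>b. x + a *\<^sub>R u + b *\<^sub>R v"
          and g = "\<lambda>y. f' y u", OF _ f'[OF mem]]) (auto intro!: derivative_eq_intros)
    then show ?thesis
      by (simp add: has_field_derivative_def linear_scale[OF lin'[OF mem]] mult_commute_abs)
  qed
  from MVT2[OF \<open>s > 0\<close> this] obtain b where b: "0 < b" "b < s"
    and "f' (x + a *\<^sub>R u + s *\<^sub>R v) u - f' (x + a *\<^sub>R u) u = s * f'' (x + a *\<^sub>R u + b *\<^sub>R v) v"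
    by auto
  with ga a b show thesis
    by (intro that[of a b]) (simp_all add: g_def)
qed

text \<open>The second difference over the parallelogram spanned by \<open>s *\<^sub>R u\<close> and \<open>s *\<^sub>R v\<close> is symmetric in
  \<open>u\<close> and \<open>v\<close>. Taking the mean values in either order expresses it by each of the two mixed
  derivatives at points close to \<open>x\<close>, and continuity of both at \<open>x\<close> yields the equality.\<close>

lemma second_derivative_symmetric_real:
  fixes f :: "'e::real_normed_vector \<Rightarrow> real"
  assumes "open S" and "x \<in> S"
    and f: "\<And>y. y \<in> S \<Longrightarrow> (f has_derivative f' y) (at y)"
    and u: "\<And>y. y \<in> S \<Longrightarrow> ((\<lambda>y. f' y u) has_derivative fu y) (at y)"
    and v: "\<And>y. y \<in> S \<Longrightarrow> ((\<lambda>y. f' y v) has_derivative fv y) (at y)"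
    and cu: "continuous_on S (\<lambda>y. fu y v)" and cv: "continuous_on S (\<lambda>y. fv y u)"
  shows "fu x v = fv x u"
proof (rule ccontr)
  assume "fu x v \<noteq> fv x u"
  define e where "e = \<bar>fu x v - fv x u\<bar> / 2"
  have "e > 0"
    using \<open>fu x v \<noteq> fv x u\<close> by (simp add: e_def)
  have tu: "((\<lambda>y. fu y v) \<longlongrightarrow> fu x v) (nhds x)" and tv: "((\<lambda>y. fv y u) \<longlongrightarrow> fv x u) (nhds x)"
    using cu cv \<open>open S\<close> \<open>x \<in> S\<close> iffD1[OF tendsto_at_iff_tendsto_nhds, of "\<lambda>y. fu y v" x]
      iffD1[OF tendsto_at_iff_tendsto_nhds, of "\<lambda>y. fv y u" x]
    by (simp_all add: continuous_on_eq_continuous_at isCont_def)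
  have "\<forall>\<^sub>F y in nhds x. y \<in> S \<and> dist (fu y v) (fu x v) < e \<and> dist (fv y u) (fv x u) < e"
    using \<open>open S\<close> \<open>x \<in> S\<close> tendstoD[OF tu \<open>e > 0\<close>] tendstoD[OF tv \<open>e > 0\<close>]
    by (auto intro!: eventually_conj eventually_nhds_in_open)
  then obtain d where "d > 0" and d: "\<And>y. dist y x < d \<Longrightarrow>
      y \<in> S \<and> dist (fu y v) (fu x v) < e \<and> dist (fv y u) (fv x u) < e"
    by (auto simp: eventually_nhds_metric)
  \<comment> \<open>This side length keeps the whole parallelogram in the ball of radius \<open>d\<close> about \<open>x\<close>.\<close>
  define s where "s = d / (norm u + norm v + 1)"
  have pos: "norm u + norm v + 1 > 0"
    by (smt (verit) norm_ge_zero)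
  have "s > 0"
    using \<open>d > 0\<close> pos by (simp add: s_def)
  have near: "dist (x + a *\<^sub>R u + b *\<^sub>R v) x < d" if "0 \<le> a" "a \<le> s" "0 \<le> b" "b \<le> s" for a b
  proof -
    have "dist (x + a *\<^sub>R u + b *\<^sub>R v) x \<le> norm (a *\<^sub>R u) + norm (b *\<^sub>R v)"
      by (simp add: dist_norm add.assoc norm_triangle_ineq del: norm_scaleR)
    also have "\<dots> \<le> s * norm u + s * norm v"
      using that by (auto intro!: add_mono mult_right_mono)
    also have "\<dots> < s * (norm u + norm v + 1)"
      using \<open>s > 0\<close> by (simp add: algebra_simps)
    also have "\<dots> = d"
      using pos by (simp add: s_def)
    finally show ?thesis .
  qed
  have in_S: "x + a *\<^sub>R u + b *\<^sub>R v \<in> S" if "0 \<le> a" "a \<le> s" "0 \<le> b" "b \<le> s" for a b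
    using d near that by blast
  have in_S': "x + a *\<^sub>R v + b *\<^sub>R u \<in> S" if "0 \<le> a" "a \<le> s" "0 \<le> b" "b \<le> s" for a b
    using in_S[of b a] that by (simp add: algebra_simps)
  obtain a b where ab: "0 < a" "a < s" "0 < b" "b < s"
    and eq1: "f (x + s *\<^sub>R u + s *\<^sub>R v) - f (x + s *\<^sub>R u) - f (x + s *\<^sub>R v) + f x
      = s * s * fu (x + a *\<^sub>R u + b *\<^sub>R v) v"
    by (rule second_difference_mean_value[of S f f' u fu s x v];
        (rule \<open>s > 0\<close> | erule f | erule u | erule (3) in_S | rule that; assumption))
  obtain a' b' where ab': "0 < a'" "a' < s" "0 < b'" "b' < s"
    and eq2: "f (x + s *\<^sub>R v + s *\<^sub>R u) - f (x + s *\<^sub>R v) - f (x + s *\<^sub>R u) + f x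
      = s * s * fv (x + a' *\<^sub>R v + b' *\<^sub>R u) u"
    by (rule second_difference_mean_value[of S f f' v fv s x u];
        (rule \<open>s > 0\<close> | erule f | erule v | erule (3) in_S' | rule that; assumption))
  have "s * s * fu (x + a *\<^sub>R u + b *\<^sub>R v) v = s * s * fv (x + b' *\<^sub>R u + a' *\<^sub>R v) u"
    using eq1 eq2 by (simp add: algebra_simps)
  then have "fu (x + a *\<^sub>R u + b *\<^sub>R v) v = fv (x + b' *\<^sub>R u + a' *\<^sub>R v) u"
    using \<open>s > 0\<close> by simp
  moreover have "dist (fu (x + a *\<^sub>R u + b *\<^sub>R v) v) (fu x v) < e"
    using d near ab by auto
  moreover have "dist (fv (x + b' *\<^sub>R u + a' *\<^sub>R v) u) (fv x u) < e"
    using d near ab' by auto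
  ultimately show False
    unfolding e_def dist_real_def by (simp add: abs_if field_simps split: if_splits)
qed

lemma smooth_on_second_derivative_symmetric:
  fixes f :: "'e::euclidean_space \<Rightarrow> 'f::euclidean_space"
  assumes "open S" and "x \<in> S" and f: "smooth_on S f"
  shows "total_deriv (total_deriv f) x u v = total_deriv (total_deriv f) x v u"
proof (rule euclidean_eqI)
  fix b :: 'f
  note J = smooth_on_total_deriv[OF \<open>open S\<close>]
  have D: "(f has_derivative total_deriv f y) (at y)" if "y \<in> S" for y
    using has_derivative_total_deriv smooth_on_differentiable f that by blast
  have D2: "(total_deriv f has_derivative total_deriv (total_deriv f) y) (at y)" if "y \<in> S" for y
    using has_derivative_total_deriv smooth_on_differentiable J f that by blast
  have c: "continuous_on S (\<lambda>y. total_deriv (total_deriv f) y v u \<bullet> b)" for u v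
    by (intro continuous_intros smooth_on_continuous J f)
  have D2': "((\<lambda>y. total_deriv f y u \<bullet> b) has_derivative (\<lambda>v. total_deriv (total_deriv f) y v u \<bullet> b)) (at y)"
    if "y \<in> S" for y u
    by (auto intro!: derivative_eq_intros D2[OF that])
  show "total_deriv (total_deriv f) x u v \<bullet> b = total_deriv (total_deriv f) x v u \<bullet> b"
    using second_derivative_symmetric_real[OF \<open>open S\<close> \<open>x \<in> S\<close>,
        of "\<lambda>x. f x \<bullet> b" "\<lambda>y u. total_deriv f y u \<bullet> b", OF has_derivative_inner_left[OF D] D2' D2' c c]
    by simp
qed

section \<open>Linear algebra of a pair of forms with nonzero volume\<close>

text \<open>A form of degree \<open>k\<close> takes a whole sequence of vectors; the first clause makes it a function
  of the entries below \<open>k\<close>.\<close>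

definition multilinear_form :: "nat \<Rightarrow> ((nat \<Rightarrow> 'e::real_vector) \<Rightarrow> real) \<Rightarrow> bool" where
  "multilinear_form k a \<longleftrightarrow> (\<forall>v w. (\<forall>i<k. v i = w i) \<longrightarrow> a v = a w) \<and>
     (\<forall>v. \<forall>i<k. linear (\<lambda>x. a (v(i := x))))"

lemma multilinear_form_cong:
  "multilinear_form k a \<Longrightarrow> (\<And>i. i < k \<Longrightarrow> v i = w i) \<Longrightarrow> a v = a w"
  unfolding multilinear_form_def by blast

lemma multilinear_form_linear:
  "multilinear_form k a \<Longrightarrow> i < k \<Longrightarrow> linear (\<lambda>x. a (v(i := x)))"
  unfolding multilinear_form_def by blast

text \<open>In the summand of a permutation \<open>\<sigma>\<close>, the vector in slot \<open>j\<close> is passed to exactly one of the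
  two factors, in the slot determined by \<open>inv \<sigma> j\<close>.\<close>

lemma multilinear_form_wedge:
  assumes a: "multilinear_form k a" and b: "multilinear_form l b"
  shows "multilinear_form (k + l) (wedge k l a b)"
  unfolding multilinear_form_def
proof (intro conjI allI impI)
  fix v w :: "nat \<Rightarrow> 'a"
  assume eq: "\<forall>i<k + l. v i = w i"
  have "a (\<lambda>i. v (\<sigma> i)) = a (\<lambda>i. w (\<sigma> i))" "b (\<lambda>i. v (\<sigma> (k + i))) = b (\<lambda>i. w (\<sigma> (k + i)))"
    if "\<sigma> permutes {..<k + l}" for \<sigma>
    using eq permutes_in_image[OF that]
    by (simp_all add: multilinear_form_cong[OF a, of "\<lambda>i. v (\<sigma> i)" "\<lambda>i. w (\<sigma> i)"]
        multilinear_form_cong[OF b, of "\<lambda>i. v (\<sigma> (k + i))" "\<lambda>i. w (\<sigma> (k + i))"])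
  then show "wedge k l a b v = wedge k l a b w"
    by (simp add: wedge_def)
next
  fix v :: "nat \<Rightarrow> 'a" and j assume j: "j < k + l"
  let ?t = "\<lambda>\<sigma> x. of_int (sign \<sigma>) * a (\<lambda>i. (v(j := x)) (\<sigma> i)) * b (\<lambda>i. (v(j := x)) (\<sigma> (k + i)))"
  have "linear (?t \<sigma>)" if \<sigma>: "\<sigma> permutes {..<k + l}" for \<sigma>
  proof -
    define m where "m = inv \<sigma> j"
    have m: "\<sigma> i = j \<longleftrightarrow> i = m" for i
      using permutes_inv_eq[OF \<sigma>] unfolding m_def by metis
    have "m < k + l"
      using permutes_in_image[OF permutes_inv[OF \<sigma>]] j by (auto simp: m_def)
    show ?thesis
    proof (cases "m < k")
      case True
      have "a (\<lambda>i. (v(j := x)) (\<sigma> i)) = a ((\<lambda>i. v (\<sigma> i))(m := x))" for x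
        by (rule arg_cong[of _ _ a]) (auto simp: m)
      moreover have "b (\<lambda>i. (v(j := x)) (\<sigma> (k + i))) = b (\<lambda>i. v (\<sigma> (k + i)))" for x
        using True by (intro multilinear_form_cong[OF b]) (auto simp: m)
      ultimately have "?t \<sigma> = (\<lambda>x. (of_int (sign \<sigma>) * b (\<lambda>i. v (\<sigma> (k + i)))) *\<^sub>R
          a ((\<lambda>i. v (\<sigma> i))(m := x)))"
        by (simp only: real_scaleR_def mult_ac)
      then show ?thesis
        by (simp only: linear_compose_scale_right multilinear_form_linear[OF a True])
    next
      case False
      then have m': "m - k < l" "k + i = m \<longleftrightarrow> i = m - k" for i
        using \<open>m < k + l\<close> by auto
      have "a (\<lambda>i. (v(j := x)) (\<sigma> i)) = a (\<lambda>i. v (\<sigma> i))" for x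
        using False by (intro multilinear_form_cong[OF a]) (auto simp: m)
      moreover have "b (\<lambda>i. (v(j := x)) (\<sigma> (k + i))) = b ((\<lambda>i. v (\<sigma> (k + i)))(m - k := x))" for x
        by (rule arg_cong[of _ _ b]) (auto simp: m m')
      ultimately have "?t \<sigma> = (\<lambda>x. (of_int (sign \<sigma>) * a (\<lambda>i. v (\<sigma> i))) *\<^sub>R
          b ((\<lambda>i. v (\<sigma> (k + i)))(m - k := x)))"
        by (simp only: real_scaleR_def)
      then show ?thesis
        by (simp only: linear_compose_scale_right multilinear_form_linear[OF b m'(1)])
    qed
  qed
  then have lin: "linear (\<lambda>x. \<Sum>\<sigma> | \<sigma> permutes {..<k + l}. ?t \<sigma> x)"
    by (intro linear_compose_sum) auto
  show "linear (\<lambda>x. wedge k l a b (v(j := x)))"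
    unfolding wedge_def
    by (rule linearI) (simp_all only: linear_add[OF lin] linear_scale[OF lin] add_divide_distrib
        real_scaleR_def times_divide_eq_right)
qed

text \<open>The antisymmetrising sum alone makes a wedge product alternating, whatever the factors: if the
  slots \<open>i\<close> and \<open>j\<close> hold the same vector, then composing with the transposition of \<open>i\<close> and \<open>j\<close>
  permutes the summands and flips their signs, so that the sum equals its negative.\<close>

lemma wedge_repeated_eq_0:
  assumes "i < k + l" and "j < k + l" and "i \<noteq> j" and "v i = v j"
  shows "wedge k l a b v = 0"
proof -
  let ?f = "\<lambda>\<sigma>. of_int (sign \<sigma>) * a (\<lambda>i. v (\<sigma> i)) * b (\<lambda>i. v (\<sigma> (k + i)))"
  let ?P = "{\<sigma>. \<sigma> permutes {..<k + l}}"
  have v: "v (Transposition.transpose i j x) = v x" for x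
    using assms(4) by (simp add: Transposition.transpose_def)
  have "?f (Transposition.transpose i j \<circ> \<sigma>) = - ?f \<sigma>" if "\<sigma> \<in> ?P" for \<sigma>
  proof -
    have "permutation \<sigma>"
      using that permutation_permutes by blast
    then have "sign (Transposition.transpose i j \<circ> \<sigma>) = - sign \<sigma>"
      using assms(3) by (simp add: sign_compose permutation_swap_id sign_swap_id)
    then show ?thesis
      by (simp add: v)
  qed
  moreover have "Transposition.transpose i j permutes {..<k + l}"
    using assms(1,2) by (intro permutes_swap_id) auto
  ultimately have "sum ?f ?P = - sum ?f ?P"
    by (subst setum_permutations_compose_left[of "Transposition.transpose i j"]) (simp_all add: sum_negf)
  then show ?thesis
    by (simp add: wedge_def)
qed

lemma multilinear_form_two_form_power: "multilinear_form (2 * n) (two_form_power B n)"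
proof (induction n)
  case 0
  then show ?case
    by (simp add: multilinear_form_def)
next
  case (Suc n)
  have "multilinear_form 2 (\<lambda>v. B (v 0) (v 1))"
    by (auto simp: multilinear_form_def less_2_cases_iff blinfun.add_left blinfun.add_right
        blinfun.scaleR_left blinfun.scaleR_right intro!: linearI)
  from multilinear_form_wedge[OF this Suc] show ?case
    by simp
qed

text \<open>Some entry is a linear combination of the others. The form is linear in the slot of that entry
  and vanishes when another entry is repeated there.\<close>

lemma alternating_form_dependent_eq_0:
  fixes T :: "(nat \<Rightarrow> 'e::euclidean_space) \<Rightarrow> real"
  assumes T: "multilinear_form d T"
    and alt: "\<And>v i j. \<lbrakk>i < d; j < d; i \<noteq> j; v i = v j\<rbrakk> \<Longrightarrow> T v = 0"
    and w: "\<And>i. i < d \<Longrightarrow> w i \<in> W" and "dim W < d"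
  shows "T w = 0"
proof (cases "inj_on w {..<d}")
  case False
  then show ?thesis
    using alt by (auto simp: inj_on_def)
next
  case True
  have "card (w ` {..<d}) > dim W"
    using \<open>dim W < d\<close> by (simp add: card_image[OF True])
  then have "dependent (w ` {..<d})"
    using w independent_card_le_dim[of "w ` {..<d}" W] by (metis image_subsetI leD lessThan_iff)
  then obtain j where j: "j < d" "w j \<in> span (w ` {..<d} - {w j})"
    by (auto simp: dependent_def)
  have "T (w(j := x)) = 0" if "x \<in> w ` {..<d} - {w j}" for x
  proof -
    from that obtain i where "i < d" "x = w i" "i \<noteq> j"
      by auto
    then show ?thesis
      using j by (intro alt[of i j]) auto
  qed
  then have "T (w(j := w j)) = 0"
    by (rule linear_eq_0_on_span[OF multilinear_form_linear[OF T j(1)] _ j(2)])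
  then show ?thesis
    by simp
qed

lemma two_form_power_compose:
  fixes B :: "'e::euclidean_space \<Rightarrow>\<^sub>L 'e \<Rightarrow>\<^sub>L real"
  assumes "\<And>x y. B (P x) (P y) = B x y"
  shows "two_form_power B n (\<lambda>i. P (v i)) = two_form_power B n v"
  by (induction n arbitrary: v) (simp_all add: wedge_def assms)

text \<open>A vector \<open>e \<noteq> 0\<close> in both kernels could be projected away: the orthogonal projection \<open>P\<close> along
  \<open>e\<close> changes neither \<open>\<omega>\<close> nor \<open>B\<close>, hence not the value of \<open>\<omega> \<and> B\<^sup>n\<close>, but it moves
  all \<open>2 * n + 1\<close> arguments into a hyperplane, where they are linearly dependent.\<close>

lemma volume_form_nondegenerate:
  fixes B :: "'e::euclidean_space \<Rightarrow>\<^sub>L 'e \<Rightarrow>\<^sub>L real" and \<omega> :: "'e \<Rightarrow>\<^sub>L real"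
  assumes "DIM('e) = 2 * n + 1"
    and skew: "\<And>x y. B x y = - B y x"
    and "wedge 1 (2 * n) (\<lambda>v. \<omega> (v 0)) (two_form_power B n) v \<noteq> 0"
    and e: "B e = 0" "\<omega> e = 0"
  shows "e = 0"
proof (rule ccontr)
  assume "e \<noteq> 0"
  define P where "P x = x - ((e \<bullet> x) / (e \<bullet> e)) *\<^sub>R e" for x
  let ?T = "wedge 1 (2 * n) (\<lambda>v. \<omega> (v 0)) (two_form_power B n)"
  have "B x e = 0" for x
    using skew[of x e] e by simp
  then have BP: "B (P x) (P y) = B x y" for x y
    by (simp add: P_def blinfun.diff_left blinfun.diff_right blinfun.scaleR_left blinfun.scaleR_right e)
  have "\<omega> (P x) = \<omega> x" for x
    by (simp add: P_def blinfun.diff_right blinfun.scaleR_right e)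
  then have "?T v = ?T (\<lambda>i. P (v i))"
    by (simp add: wedge_def two_form_power_compose[of B P, OF BP])
  also have "\<dots> = 0"
  proof (rule alternating_form_dependent_eq_0[where T = ?T and d = "1 + 2 * n" and W = "{x. e \<bullet> x = 0}"])
    have "multilinear_form 1 (\<lambda>v. \<omega> (v 0))"
      by (auto simp: multilinear_form_def blinfun.add_right blinfun.scaleR_right intro!: linearI)
    from multilinear_form_wedge[OF this multilinear_form_two_form_power]
    show "multilinear_form (1 + 2 * n) ?T" .
    show "P (v i) \<in> {x. e \<bullet> x = 0}" for i
      using \<open>e \<noteq> 0\<close> by (simp add: P_def inner_diff_right)
    show "dim {x. e \<bullet> x = 0} < 1 + 2 * n"
      using dim_hyperplane[OF \<open>e \<noteq> 0\<close>] assms(1) by simp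
  qed (rule wedge_repeated_eq_0)
  finally show False
    using assms(3) by contradiction
qed

lemma kernel_two_form:
  fixes B :: "'e::euclidean_space \<Rightarrow>\<^sub>L 'e \<Rightarrow>\<^sub>L real" and \<omega> :: "'e \<Rightarrow>\<^sub>L real"
  assumes nondeg: "\<And>e. B e = 0 \<Longrightarrow> \<omega> e = 0 \<Longrightarrow> e = 0"
    and "\<omega> E = 1" and "B E = 0" and "B u = 0"
  shows "u = \<omega> u *\<^sub>R E"
  using nondeg[of "u - \<omega> u *\<^sub>R E"] assms(2-)
  by (simp add: blinfun.diff_right blinfun.scaleR_right)

text \<open>The map \<open>u \<mapsto> B u + \<omega> u *\<^sub>R \<omega>\<close> into the dual space is injective, because \<open>B u\<close> vanishes at
  \<open>E\<close> and hence \<open>\<omega> u\<close> can be read off at \<open>E\<close>. By finite dimension it is surjective, and if its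
  value \<open>\<alpha>\<close> vanishes at \<open>E\<close>, then the second summand is zero.\<close>

lemma range_two_form:
  fixes B :: "'e::euclidean_space \<Rightarrow>\<^sub>L 'e \<Rightarrow>\<^sub>L real" and \<omega> \<alpha> :: "'e \<Rightarrow>\<^sub>L real"
  assumes nondeg: "\<And>e. B e = 0 \<Longrightarrow> \<omega> e = 0 \<Longrightarrow> e = 0"
    and skew: "\<And>x y. B x y = - B y x"
    and E: "\<omega> E = 1" "B E = 0" and "\<alpha> E = 0"
  shows "\<exists>u. \<alpha> = B u"
proof -
  \<comment> \<open>The coordinates of \<open>B u + \<omega> u *\<^sub>R \<omega>\<close>.\<close>
  define G where "G u = (\<Sum>b\<in>Basis. (B u b + \<omega> u * \<omega> b) *\<^sub>R b)" for u
  have G: "(G u \<bullet> b) = B u b + \<omega> u * \<omega> b" if "b \<in> Basis" for u b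
    using that by (simp add: G_def)
  have BE: "B x E = 0" for x
    using skew[of x E] E by simp
  have "linear G"
    by (rule linearI)
      (simp_all add: G_def blinfun.add_left blinfun.add_right blinfun.scaleR_left
        blinfun.scaleR_right algebra_simps sum.distrib scaleR_sum_right)
  moreover have "u = 0" if "G u = 0" for u
  proof -
    have "B u + \<omega> u *\<^sub>R \<omega> = 0"
      using G[of _ u] that by (intro blinfun_euclidean_eqI) (simp add: blinfun.add_left blinfun.scaleR_left)
    then have eq: "B u y + \<omega> u * \<omega> y = 0" for y
      by (metis blinfun.add_left blinfun.scaleR_left blinfun.zero_left real_scaleR_def)
    from eq[of E] have "\<omega> u = 0"
      using BE E by simp
    with eq nondeg show ?thesis
      by (simp add: blinfun_eqI)
  qed
  ultimately have "surj G"
    by (intro linear_injective_imp_surjective) (auto simp: linear_injective_0)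
  then obtain u where "G u = (\<Sum>b\<in>Basis. \<alpha> b *\<^sub>R b)"
    by (metis surjD)
  then have "G u \<bullet> b = \<alpha> b" if "b \<in> Basis" for b
    using that by simp
  then have \<alpha>: "\<alpha> = B u + \<omega> u *\<^sub>R \<omega>"
    using G by (intro blinfun_euclidean_eqI) (simp add: blinfun.add_left blinfun.scaleR_left)
  then have "\<omega> u = 0"
    using \<open>\<alpha> E = 0\<close> BE E by (simp add: blinfun.add_left blinfun.scaleR_left)
  with \<alpha> show ?thesis
    by auto
qed

text \<open>Testing \<open>\<alpha>\<^sup>\<sharp>\<close> on the coordinate functionals forces its coordinates, and by linearity the
  vector with these coordinates has the right value on every covector.\<close>

lemma sharp_components:
  fixes \<Lambda> :: "('m, 'e::euclidean_space) two_vector_field"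
  shows "sharp \<Lambda> c p \<alpha> = (\<Sum>b\<in>Basis. \<Lambda> c p \<alpha> (blinfun_inner_left b) *\<^sub>R b)" (is "_ = ?v")
    and apply_sharp: "blinfun_apply \<beta> (sharp \<Lambda> c p \<alpha>) = \<Lambda> c p \<alpha> \<beta>"
proof -
  have v: "blinfun_apply \<beta> ?v = \<Lambda> c p \<alpha> \<beta>" for \<beta>
  proof -
    have "\<beta> = (\<Sum>b\<in>Basis. \<beta> b *\<^sub>R blinfun_inner_left b)"
      by (rule blinfun_euclidean_eqI) (simp add: blinfun.sum_left blinfun.scaleR_left inner_sum_left
          inner_not_same_Basis inner_Basis if_distrib cong: if_cong)
    then have "\<Lambda> c p \<alpha> \<beta> = \<Lambda> c p \<alpha> (\<Sum>b\<in>Basis. \<beta> b *\<^sub>R blinfun_inner_left b)"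
      by simp
    then show ?thesis
      by (simp add: blinfun.sum_right blinfun.scaleR_right mult.commute)
  qed
  show *: "sharp \<Lambda> c p \<alpha> = ?v"
    unfolding sharp_def
  proof (rule the_equality)
    fix w assume "\<forall>\<beta>. blinfun_apply \<beta> w = \<Lambda> c p \<alpha> \<beta>"
    then have "blinfun_inner_left b w = blinfun_inner_left b ?v" for b
      using v by metis
    then have "w \<bullet> b = ?v \<bullet> b" for b
      by simp
    then show "w = ?v"
      using vector_eq_rdot by blast
  qed (simp add: v)
  show "blinfun_apply \<beta> (sharp \<Lambda> c p \<alpha>) = \<Lambda> c p \<alpha> \<beta>"
    unfolding * by (rule v)
qed

section \<open>Calculus in a chart\<close>

lemma chart_inv_coord: "is_chart c \<Longrightarrow> p \<in> chart_dom c \<Longrightarrow> chart_inv c (coord c p) = p"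
  unfolding is_chart_def homeomorphism_def by blast

lemma in_chart_coord: "is_chart c \<Longrightarrow> p \<in> chart_dom c \<Longrightarrow> in_chart c F (coord c p) = F p"
  by (simp add: in_chart_def chart_inv_coord)

lemma open_coord_image:
  assumes "is_chart c" and "open U" and "U \<subseteq> chart_dom c"
  shows "open (coord c ` U)"
proof -
  have "continuous_on (coord c ` chart_dom c) (chart_inv c)" "open (coord c ` chart_dom c)"
    using assms(1) by (auto simp: is_chart_def homeomorphism_def)
  then have "open (chart_inv c -` U \<inter> coord c ` chart_dom c)"
    using \<open>open U\<close> by (simp add: continuous_on_open_vimage)
  moreover have "chart_inv c -` U \<inter> coord c ` chart_dom c = coord c ` U"
    using assms(1,3) by (auto simp: chart_inv_coord subset_iff image_iff)
  ultimately show ?thesis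
    by simp
qed

lemma chart_deriv_total_deriv: "chart_deriv c F p = total_deriv (in_chart c F) (coord c p)"
  by (simp add: chart_deriv_def total_deriv_def)

lemma has_derivative_chart_deriv:
  "in_chart c F differentiable (at (coord c p)) \<Longrightarrow>
    (in_chart c F has_derivative chart_deriv c F p) (at (coord c p))"
  by (simp add: chart_deriv_total_deriv has_derivative_total_deriv)

lemma chart_deriv_unique:
  "(in_chart c F has_derivative F') (at (coord c p)) \<Longrightarrow> blinfun_apply (chart_deriv c F p) = F'"
  by (simp add: chart_deriv_total_deriv total_deriv_unique)

text \<open>Stated for open \<open>U\<close> inside of the chart domain, since identities between the local
  representations in two charts hold on the overlap only.\<close>

lemma has_derivative_in_chart_cong:
  assumes "is_chart c" and "open U" and "U \<subseteq> chart_dom c" and "p \<in> U"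
    and "\<And>q. q \<in> U \<Longrightarrow> F q = G q"
    and "(in_chart c G has_derivative D) (at (coord c p))"
  shows "(in_chart c F has_derivative D) (at (coord c p))"
proof (rule has_derivative_transform_within_open[OF assms(6) open_coord_image[OF assms(1-3)]])
  show "in_chart c G x = in_chart c F x" if "x \<in> coord c ` U" for x
    using that assms(1,3,5) by (auto simp: in_chart_coord subset_iff)
qed (use assms(4) in simp)

lemma chart_deriv_cong:
  assumes "is_chart c" and "open U" and "U \<subseteq> chart_dom c" and "p \<in> U"
    and "\<And>q. q \<in> U \<Longrightarrow> F q = G q"
    and "in_chart c G differentiable (at (coord c p))"
  shows "chart_deriv c F p = chart_deriv c G p"
  using chart_deriv_unique[OF has_derivative_in_chart_cong[OF assms(1-5)
        has_derivative_chart_deriv[OF assms(6)]]]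
  by (simp add: blinfun_apply_inject)

lemma chart_deriv_const: "chart_deriv c (\<lambda>q. v) p = 0"
  by (intro blinfun_eqI) (simp add: chart_deriv_unique[of _ _ "\<lambda>_. 0"] in_chart_def)

lemma chart_deriv_minus:
  assumes "in_chart c F differentiable (at (coord c p))"
  shows "chart_deriv c (\<lambda>q. - F q) p = - chart_deriv c F p"
  using has_derivative_minus[OF has_derivative_chart_deriv[OF assms]]
  by (intro blinfun_eqI) (simp add: chart_deriv_unique in_chart_def blinfun.minus_left)

lemma chart_deriv_blinfun_apply:
  assumes "is_chart c" and "p \<in> chart_dom c"
    and "in_chart c \<Phi> differentiable (at (coord c p))"
    and "in_chart c V differentiable (at (coord c p))"
  shows "chart_deriv c (\<lambda>q. blinfun_apply (\<Phi> q) (V q)) p u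
    = \<Phi> p (chart_deriv c V p u) + chart_deriv c \<Phi> p u (V p)"
proof -
  have "((\<lambda>x. blinfun_apply (in_chart c \<Phi> x) (in_chart c V x)) has_derivative
      (\<lambda>u. in_chart c \<Phi> (coord c p) (chart_deriv c V p u)
        + chart_deriv c \<Phi> p u (in_chart c V (coord c p)))) (at (coord c p))"
    by (rule bounded_bilinear.FDERIV[OF bounded_bilinear_blinfun_apply
          has_derivative_chart_deriv[OF assms(3)] has_derivative_chart_deriv[OF assms(4)]])
  then have "(in_chart c (\<lambda>q. blinfun_apply (\<Phi> q) (V q)) has_derivative
      (\<lambda>u. \<Phi> p (chart_deriv c V p u) + chart_deriv c \<Phi> p u (V p))) (at (coord c p))"
    by (simp add: in_chart_coord[OF assms(1,2)]) (simp add: in_chart_def)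
  then show ?thesis
    by (simp add: chart_deriv_unique)
qed

lemma in_chart_chart_deriv:
  assumes "is_chart c" and "x \<in> coord c ` chart_dom c"
  shows "in_chart c (chart_deriv c F) x = total_deriv (in_chart c F) x"
  using assms by (auto simp: in_chart_coord chart_deriv_total_deriv)

lemma smooth_on_chart_deriv:
  assumes "is_chart c" and "open U" and "U \<subseteq> chart_dom c"
    and "smooth_on (coord c ` U) (in_chart c F)"
  shows "smooth_on (coord c ` U) (in_chart c (chart_deriv c F))"
  using open_coord_image[OF assms(1-3)] assms
  by (auto intro!: smooth_on_cong[OF _ _ smooth_on_total_deriv] in_chart_chart_deriv)

lemma chart_deriv_symmetric:
  fixes F :: "'m::topological_space \<Rightarrow> 'f::euclidean_space"
  assumes "is_chart c" and "open U" and "U \<subseteq> chart_dom c" and "p \<in> U"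
    and "smooth_on (coord c ` U) (in_chart c F)"
  shows "chart_deriv c (chart_deriv c F) p u v = chart_deriv c (chart_deriv c F) p v u"
proof -
  note op = open_coord_image[OF assms(1-3)]
  have p: "coord c p \<in> coord c ` U"
    using assms(4) by simp
  have "(total_deriv (in_chart c F) has_derivative
      total_deriv (total_deriv (in_chart c F)) (coord c p)) (at (coord c p))"
    using smooth_on_total_deriv[OF op assms(5)] p
    by (intro has_derivative_total_deriv smooth_on_differentiable)
  then have "(in_chart c (chart_deriv c F) has_derivative
      total_deriv (total_deriv (in_chart c F)) (coord c p)) (at (coord c p))"
    by (rule has_derivative_transform_within_open[OF _ op p])
      (use assms(1,3) in \<open>auto simp: in_chart_chart_deriv\<close>)
  from chart_deriv_unique[OF this] show ?thesis
    using smooth_on_second_derivative_symmetric[OF op p assms(5)] by simp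
qed

lemma smooth_in_differentiable:
  "smooth_in c F \<Longrightarrow> p \<in> chart_dom c \<Longrightarrow> in_chart c F differentiable (at (coord c p))"
  unfolding smooth_in_def by (rule smooth_on_differentiable) auto

lemma smooth_in_cong:
  assumes "is_chart c" and "\<And>p. p \<in> chart_dom c \<Longrightarrow> F p = G p" and "smooth_in c G"
  shows "smooth_in c F"
  unfolding smooth_in_def
proof (rule smooth_on_cong[OF _ _ assms(3)[unfolded smooth_in_def]])
  show "open (coord c ` chart_dom c)"
    using assms(1) by (simp add: is_chart_def)
  show "in_chart c F x = in_chart c G x" if "x \<in> coord c ` chart_dom c" for x
    using that assms(2) by (auto simp: in_chart_coord[OF assms(1)])
qed

lemma smooth_in_const: "smooth_in c (\<lambda>p. y)"
  by (simp add: smooth_in_def in_chart_def smooth_on_def Ck_on_const)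

lemma smooth_in_chart_deriv: "is_chart c \<Longrightarrow> smooth_in c F \<Longrightarrow> smooth_in c (chart_deriv c F)"
  unfolding smooth_in_def by (auto intro: smooth_on_chart_deriv simp: is_chart_def)

lemma smooth_in_bounded_bilinear:
  "is_chart c \<Longrightarrow> bounded_bilinear B \<Longrightarrow> smooth_in c F \<Longrightarrow> smooth_in c G \<Longrightarrow>
    smooth_in c (\<lambda>p. B (F p) (G p))"
  using smooth_on_bounded_bilinear[of "coord c ` chart_dom c" B "in_chart c F" "in_chart c G"]
  by (simp add: smooth_in_def in_chart_def is_chart_def)

lemmas smooth_in_blinfun_apply =
  smooth_in_bounded_bilinear[OF _ bounded_bilinear_blinfun_apply]

lemma smooth_in_bounded_linear:
  "is_chart c \<Longrightarrow> bounded_linear L \<Longrightarrow> smooth_in c F \<Longrightarrow> smooth_in c (\<lambda>p. L (F p))"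
  using smooth_on_bounded_linear[of "coord c ` chart_dom c" L "in_chart c F"]
  by (simp add: smooth_in_def in_chart_def is_chart_def)

lemma smooth_in_add:
  "is_chart c \<Longrightarrow> smooth_in c F \<Longrightarrow> smooth_in c G \<Longrightarrow> smooth_in c (\<lambda>p. F p + G p)"
  using smooth_on_add[of "coord c ` chart_dom c" "in_chart c F" "in_chart c G"]
  by (simp add: smooth_in_def in_chart_def is_chart_def)

lemma smooth_in_diff:
  "is_chart c \<Longrightarrow> smooth_in c F \<Longrightarrow> smooth_in c G \<Longrightarrow> smooth_in c (\<lambda>p. F p - G p)"
  using smooth_on_diff[of "coord c ` chart_dom c" "in_chart c F" "in_chart c G"]
  by (simp add: smooth_in_def in_chart_def is_chart_def)

lemma smooth_in_sum:
  "is_chart c \<Longrightarrow> (\<And>i. i \<in> I \<Longrightarrow> smooth_in c (F i)) \<Longrightarrow> smooth_in c (\<lambda>p. \<Sum>i\<in>I. F i p)"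
  using smooth_on_sum[of "coord c ` chart_dom c" I "\<lambda>i. in_chart c (F i)"]
  by (simp add: smooth_in_def in_chart_def is_chart_def)

section \<open>Interior product of a closed two-form with a Lie bracket\<close>

text \<open>In terms of interior products and Lie derivatives this is
  \<open>i\<^bsub>[X,Y]\<^esub> \<Omega> = L\<^bsub>X\<^esub> i\<^bsub>Y\<^esub> \<Omega> - i\<^bsub>Y\<^esub> L\<^bsub>X\<^esub> \<Omega> = d (X \<cdot> g)\<close>: here \<open>L\<^bsub>X\<^esub> \<Omega> = d (i\<^bsub>X\<^esub> \<Omega>) = d (d f) = 0\<close>
  by closedness, and \<open>L\<^bsub>X\<^esub> (d g) = d (X \<cdot> g)\<close>. In a chart, it follows by differentiating the two
  equations \<open>i\<^bsub>X\<^esub> \<Omega> = d f\<close> and \<open>i\<^bsub>Y\<^esub> \<Omega> = d g\<close> with the product rule, using that the second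
  derivatives of \<open>f\<close> and \<open>g\<close> are symmetric and that the derivatives of \<open>\<Omega>\<close> sum to zero
  cyclically.\<close>

lemma interior_product_bracket:
  fixes \<Omega> :: "'m::topological_space \<Rightarrow> 'e::euclidean_space \<Rightarrow>\<^sub>L 'e \<Rightarrow>\<^sub>L real" and f g :: "'m \<Rightarrow> real"
  assumes c: "is_chart c" and p: "p \<in> chart_dom c"
    and smooth: "smooth_in c \<Omega>" "smooth_in c X" "smooth_in c Y" "smooth_in c f" "smooth_in c g"
    and skew: "\<And>q u v. q \<in> chart_dom c \<Longrightarrow> \<Omega> q u v = - \<Omega> q v u"
    and closed: "\<And>u v w. chart_deriv c (\<lambda>q. \<Omega> q v w) p u + chart_deriv c (\<lambda>q. \<Omega> q w u) p v
      + chart_deriv c (\<lambda>q. \<Omega> q u v) p w = 0"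
    and X: "\<And>q. q \<in> chart_dom c \<Longrightarrow> \<Omega> q (X q) = chart_deriv c f q"
    and Y: "\<And>q. q \<in> chart_dom c \<Longrightarrow> \<Omega> q (Y q) = chart_deriv c g q"
  shows "\<Omega> p (chart_deriv c Y p (X p) - chart_deriv c X p (Y p))
    = chart_deriv c (\<lambda>q. chart_deriv c g q (X q)) p"
proof (rule blinfun_eqI)
  fix w
  have op: "open (chart_dom c)"
    using c by (simp add: is_chart_def)
  note diff = smooth_in_differentiable[OF _ p]
  note cong = chart_deriv_cong[OF c op order_refl p]
  note product = chart_deriv_blinfun_apply[OF c p diff diff]
  let ?\<Omega>' = "chart_deriv c \<Omega> p"
  have ext_deriv: "chart_deriv c (\<lambda>q. \<Omega> q v w) p u = ?\<Omega>' u v w" for u v w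
    using smooth
    by (simp add: product smooth_in_const chart_deriv_const smooth_in_blinfun_apply c
        blinfun.zero_left blinfun.add_left)
  have lieX: "\<Omega> p (chart_deriv c X p u) v + ?\<Omega>' u (X p) v = chart_deriv c (chart_deriv c f) p u v" for u v
    using product[OF smooth(1,2), of u] cong[OF X diff[OF smooth_in_chart_deriv[OF c smooth(4)]]]
    by (simp flip: blinfun.add_left)
  have lieY: "\<Omega> p (chart_deriv c Y p u) v + ?\<Omega>' u (Y p) v = chart_deriv c (chart_deriv c g) p u v" for u v
    using product[OF smooth(1,3), of u] cong[OF Y diff[OF smooth_in_chart_deriv[OF c smooth(5)]]]
    by (simp flip: blinfun.add_left)
  have sym: "chart_deriv c (chart_deriv c F) p u v = chart_deriv c (chart_deriv c F) p v u"
    if "smooth_in c F" for F :: "'m \<Rightarrow> real" and u v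
    using chart_deriv_symmetric[OF c op order_refl p] that unfolding smooth_in_def by blast
  have skew': "?\<Omega>' u v w = - ?\<Omega>' u w v" for u v w
  proof -
    have smooth': "smooth_in c (\<lambda>q. \<Omega> q w v)"
      using smooth by (simp add: smooth_in_const smooth_in_blinfun_apply c)
    have "chart_deriv c (\<lambda>q. \<Omega> q v w) p = chart_deriv c (\<lambda>q. - \<Omega> q w v) p"
      by (rule cong[OF skew diff[OF smooth_in_bounded_linear[OF c bounded_linear_minus[OF bounded_linear_ident] smooth']]])
    also have "\<dots> = - chart_deriv c (\<lambda>q. \<Omega> q w v) p"
      by (rule chart_deriv_minus[OF diff[OF smooth']])
    finally show ?thesis
      by (simp flip: ext_deriv add: blinfun.minus_left)
  qed
  have "chart_deriv c (\<lambda>q. chart_deriv c g q (X q)) p w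
    = chart_deriv c g p (chart_deriv c X p w) + chart_deriv c (chart_deriv c g) p w (X p)"
    by (rule product[OF smooth_in_chart_deriv[OF c smooth(5)] smooth(2)])
  moreover have "chart_deriv c g p (chart_deriv c X p w) = - \<Omega> p (chart_deriv c X p w) (Y p)"
    using Y[OF p] skew[OF p] by metis
  moreover have "?\<Omega>' (X p) (Y p) w + ?\<Omega>' (Y p) w (X p) + ?\<Omega>' w (X p) (Y p) = 0"
    using closed[of "X p" "Y p" w] by (simp add: ext_deriv)
  ultimately show "\<Omega> p (chart_deriv c Y p (X p) - chart_deriv c X p (Y p)) w
    = chart_deriv c (\<lambda>q. chart_deriv c g q (X q)) p w"
    using lieY[of "X p" w] lieX[of "Y p" w] lieX[of w "Y p"] sym[OF smooth(4), of w "Y p"]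
      sym[OF smooth(5), of w "X p"] skew'[of "Y p" w "X p"]
    by (simp add: blinfun.diff_left blinfun.diff_right)
qed

section \<open>Tensor fields under coordinate changes\<close>

lemma smooth_manifold_chart: "smooth_manifold A \<Longrightarrow> c \<in> A \<Longrightarrow> is_chart c"
  by (simp add: smooth_manifold_def)

lemma open_overlap: "is_chart c \<Longrightarrow> is_chart d \<Longrightarrow> open (chart_dom c \<inter> chart_dom d)"
  by (simp add: is_chart_def open_Int)

lemma coordinate_change_differentiable:
  assumes "smooth_manifold A" and "c \<in> A" and "d \<in> A" and "p \<in> chart_dom c \<inter> chart_dom d"
  shows "in_chart c (coord d) differentiable (at (coord c p))"
  using assms unfolding smooth_manifold_def
  by (metis smooth_on_differentiable imageI)

lemma chart_deriv_chain:
  assumes A: "smooth_manifold A" and c: "c \<in> A" and d: "d \<in> A"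
    and p: "p \<in> chart_dom c \<inter> chart_dom d" and "smooth_in d F"
  shows "chart_deriv c F p = chart_deriv d F p o\<^sub>L chart_deriv c (coord d) p"
proof -
  note charts = smooth_manifold_chart[OF A c] smooth_manifold_chart[OF A d]
  have eq: "in_chart c (coord d) (coord c p) = coord d p"
    using p by (simp add: in_chart_coord[OF charts(1)])
  have "(in_chart d F has_derivative chart_deriv d F p) (at (in_chart c (coord d) (coord c p)))"
    using assms(5) p unfolding eq
    by (intro has_derivative_chart_deriv smooth_in_differentiable) auto
  from has_derivative_compose[OF has_derivative_chart_deriv[OF
        coordinate_change_differentiable[OF A c d p]] this]
  have "(in_chart c (\<lambda>q. in_chart d F (coord d q)) has_derivative
      (\<lambda>u. chart_deriv d F p (chart_deriv c (coord d) p u))) (at (coord c p))"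
    by (simp add: in_chart_def)
  then have "(in_chart c F has_derivative
      (\<lambda>u. chart_deriv d F p (chart_deriv c (coord d) p u))) (at (coord c p))"
    by (rule has_derivative_in_chart_cong[OF charts(1) open_overlap[OF charts] _ p, rotated 2])
      (auto simp: in_chart_coord[OF charts(2)])
  from chart_deriv_unique[OF this] show ?thesis
    by (intro blinfun_eqI) simp
qed

lemma vector_field_smooth: "is_vector_field A X \<Longrightarrow> c \<in> A \<Longrightarrow> smooth_in c (X c)"
  by (simp add: is_vector_field_def)

lemma vector_field_transform:
  "is_vector_field A X \<Longrightarrow> c \<in> A \<Longrightarrow> d \<in> A \<Longrightarrow> p \<in> chart_dom c \<inter> chart_dom d \<Longrightarrow>
    X d p = chart_deriv c (coord d) p (X c p)"
  unfolding is_vector_field_def by blast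

lemma one_form_smooth: "is_one_form A \<alpha> \<Longrightarrow> c \<in> A \<Longrightarrow> smooth_in c (\<alpha> c)"
  by (simp add: is_one_form_def)

lemma one_form_transform:
  "is_one_form A \<alpha> \<Longrightarrow> c \<in> A \<Longrightarrow> d \<in> A \<Longrightarrow> p \<in> chart_dom c \<inter> chart_dom d \<Longrightarrow>
    \<alpha> c p = \<alpha> d p o\<^sub>L chart_deriv c (coord d) p"
  unfolding is_one_form_def by blast

lemma is_one_form_differential:
  assumes "smooth_manifold A" and "smooth_fun A f"
  shows "is_one_form A (differential f)"
proof -
  have eq: "differential f c = chart_deriv c f" for c
    by (simp add: differential_def fun_eq_iff)
  show ?thesis
    unfolding is_one_form_def eq
  proof (intro conjI ballI)
    show "smooth_in c (chart_deriv c f)" if "c \<in> A" for c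
      using that assms by (simp add: smooth_in_chart_deriv smooth_manifold_chart smooth_fun_def)
    show "chart_deriv c f p = chart_deriv d f p o\<^sub>L chart_deriv c (coord d) p"
      if "c \<in> A" "d \<in> A" "p \<in> chart_dom c \<inter> chart_dom d" for c d p
      using chart_deriv_chain[OF assms(1) that, of f] that assms(2) by (simp add: smooth_fun_def)
  qed
qed

text \<open>Differentiating \<open>Z\<^sub>d = J Z\<^sub>c\<close>, where \<open>J\<close> is the Jacobian of the coordinate change, gives an extra
  term with the derivative of \<open>J\<close>. For the two vector fields these terms agree by symmetry of the
  second derivative of the coordinate change, and they cancel in the bracket.\<close>

lemma lie_bracket_transform:
  assumes A: "smooth_manifold A" and c: "c \<in> A" and d: "d \<in> A"
    and p: "p \<in> chart_dom c \<inter> chart_dom d"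
    and X: "is_vector_field A X" and Y: "is_vector_field A Y"
  shows "lie_bracket X Y d p = chart_deriv c (coord d) p (lie_bracket X Y c p)"
proof -
  note charts = smooth_manifold_chart[OF A c] smooth_manifold_chart[OF A d]
  note U = open_overlap[OF charts] Int_lower1
  let ?J = "chart_deriv c (coord d)"
  have J: "smooth_on (coord c ` (chart_dom c \<inter> chart_dom d)) (in_chart c (coord d))"
    using A c d by (simp add: smooth_manifold_def)
  then have dJ: "in_chart c ?J differentiable (at (coord c p))"
    using smooth_on_chart_deriv[OF charts(1) U] smooth_on_differentiable p by blast
  have "chart_deriv d (Z d) p (?J p u) = ?J p (chart_deriv c (Z c) p u) + chart_deriv c ?J p u (Z c p)"
    if Z: "is_vector_field A Z" for Z u
  proof -
    have dZ: "in_chart c (Z c) differentiable (at (coord c p))"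
      using p by (intro smooth_in_differentiable vector_field_smooth[OF Z c]) simp
    have "chart_deriv d (Z d) p (?J p u) = chart_deriv c (Z d) p u"
      using chart_deriv_chain[OF A c d p vector_field_smooth[OF Z d]] by simp
    also have "chart_deriv c (Z d) p = chart_deriv c (\<lambda>q. ?J q (Z c q)) p"
    proof (rule chart_deriv_cong[OF charts(1) U p])
      show "Z d q = ?J q (Z c q)" if "q \<in> chart_dom c \<inter> chart_dom d" for q
        using vector_field_transform[OF Z c d that] .
      show "in_chart c (\<lambda>q. ?J q (Z c q)) differentiable (at (coord c p))"
        using differentiableI[OF bounded_bilinear.FDERIV[OF bounded_bilinear_blinfun_apply
              has_derivative_chart_deriv[OF dJ] has_derivative_chart_deriv[OF dZ]]]
        by (simp add: in_chart_def)
    qed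
    also have "\<dots> u = ?J p (chart_deriv c (Z c) p u) + chart_deriv c ?J p u (Z c p)"
      using p by (intro chart_deriv_blinfun_apply charts dJ dZ) simp
    finally show ?thesis .
  qed
  from this[OF X, of "Y c p"] this[OF Y, of "X c p"] show ?thesis
    using chart_deriv_symmetric[OF charts(1) U p J, of "X c p" "Y c p"]
      vector_field_transform[OF X c d p] vector_field_transform[OF Y c d p]
    by (simp add: lie_bracket_def blinfun.diff_right)
qed

lemma is_vector_field_lie_bracket:
  assumes A: "smooth_manifold A" and X: "is_vector_field A X" and Y: "is_vector_field A Y"
  shows "is_vector_field A (lie_bracket X Y)"
proof -
  have "smooth_in c (lie_bracket X Y c)" if "c \<in> A" for c
    unfolding lie_bracket_def
    by (intro smooth_in_diff smooth_in_blinfun_apply smooth_in_chart_deriv smooth_manifold_chart[OF A that]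
        vector_field_smooth[OF X that] vector_field_smooth[OF Y that])
  then show ?thesis
    using lie_bracket_transform[OF A _ _ _ X Y] unfolding is_vector_field_def by blast
qed

text \<open>The vector \<open>df\<^sup>\<sharp>\<close> transforms correctly because it is characterised by the values
  \<open>\<beta> (df\<^sup>\<sharp>) = \<Lambda> (df, \<beta>)\<close> of all covectors \<open>\<beta>\<close>, which are invariant.\<close>

lemma is_vector_field_pre_hamiltonian_lift:
  assumes A: "smooth_manifold A" and E: "is_vector_field A E" and \<Lambda>: "is_two_vector_field A \<Lambda>"
    and f: "smooth_fun A f" and h: "smooth_fun A h"
  shows "is_vector_field A (pre_hamiltonian_lift E \<Lambda> f h)"
  unfolding is_vector_field_def
proof (intro conjI ballI)
  note df = is_one_form_differential[OF A f]
  fix c assume c: "c \<in> A"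
  note chart = smooth_manifold_chart[OF A c]
  show "smooth_in c (pre_hamiltonian_lift E \<Lambda> f h c)"
  proof -
    have "smooth_in c (chart_deriv c f)" "smooth_in c (\<Lambda> c)" "smooth_in c (E c)" "smooth_in c h"
      using c f h E \<Lambda> smooth_in_chart_deriv[OF chart]
      by (auto simp: smooth_fun_def is_vector_field_def is_two_vector_field_def)
    then show ?thesis
      unfolding pre_hamiltonian_lift_def sharp_components differential_def
      by (intro smooth_in_add[OF chart] smooth_in_sum[OF chart] smooth_in_const
          smooth_in_blinfun_apply[OF chart]
          smooth_in_bounded_bilinear[OF chart bounded_bilinear_scaleR])
  qed
  fix d p assume d: "d \<in> A" and p: "p \<in> chart_dom c \<inter> chart_dom d"
  let ?J = "chart_deriv c (coord d) p"
  have df_eq: "differential f c p = differential f d p o\<^sub>L ?J"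
    by (rule one_form_transform[OF df c d p])
  have "blinfun_apply \<beta> (sharp \<Lambda> d p (differential f d p)) = \<beta> (?J (sharp \<Lambda> c p (differential f c p)))"
    for \<beta> :: "'b \<Rightarrow>\<^sub>L real"
  proof -
    have "\<Lambda> d p (differential f d p) \<beta> = \<Lambda> c p (differential f d p o\<^sub>L ?J) (\<beta> o\<^sub>L ?J)"
      using \<Lambda> c d p unfolding is_two_vector_field_def by blast
    also have "\<dots> = (\<beta> o\<^sub>L ?J) (sharp \<Lambda> c p (differential f c p))"
      by (simp only: apply_sharp df_eq)
    finally show ?thesis
      by (simp add: apply_sharp[of \<beta> \<Lambda> d p])
  qed
  from this[of "blinfun_inner_left b" for b]
  have "sharp \<Lambda> d p (differential f d p) = ?J (sharp \<Lambda> c p (differential f c p))"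
    using vector_eq_rdot by (metis blinfun_inner_left.rep_eq)
  then show "pre_hamiltonian_lift E \<Lambda> f h d p = ?J (pre_hamiltonian_lift E \<Lambda> f h c p)"
    using vector_field_transform[OF E c d p]
    by (simp add: pre_hamiltonian_lift_def blinfun.add_right blinfun.scaleR_right)
qed

text \<open>The local expressions \<open>\<alpha> c p (X c p)\<close> agree on overlaps and thus glue to one function on the
  manifold, whose value at \<open>p\<close> may be computed in an arbitrary chart at \<open>p\<close>.\<close>

lemma contraction:
  assumes A: "smooth_manifold A" and \<alpha>: "is_one_form A \<alpha>" and X: "is_vector_field A X"
  obtains f where "smooth_fun A f"
    and "\<And>c p. c \<in> A \<Longrightarrow> p \<in> chart_dom c \<Longrightarrow> f p = \<alpha> c p (X c p)"
proof -
  have indep: "\<alpha> d p (X d p) = \<alpha> c p (X c p)"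
    if "c \<in> A" "d \<in> A" "p \<in> chart_dom c" "p \<in> chart_dom d" for c d p
    using that one_form_transform[OF \<alpha>, of c d p] vector_field_transform[OF X, of c d p] by simp
  \<comment> \<open>The choice of the chart does not matter by independence.\<close>
  define f where "f p = (let c = SOME c. c \<in> A \<and> p \<in> chart_dom c in \<alpha> c p (X c p))" for p
  have f: "f p = \<alpha> c p (X c p)" if "c \<in> A" "p \<in> chart_dom c" for c p
  proof -
    let ?d = "SOME d. d \<in> A \<and> p \<in> chart_dom d"
    have "?d \<in> A \<and> p \<in> chart_dom ?d"
      by (rule someI[of _ c]) (simp add: that)
    then show ?thesis
      unfolding f_def Let_def using indep that by blast
  qed
  have "smooth_in c f" if "c \<in> A" for c
  proof (rule smooth_in_cong[OF smooth_manifold_chart[OF A that] f[OF that]])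
    show "smooth_in c (\<lambda>p. \<alpha> c p (X c p))"
      by (rule smooth_in_blinfun_apply[OF smooth_manifold_chart[OF A that]
            one_form_smooth[OF \<alpha> that] vector_field_smooth[OF X that]])
  qed
  then show thesis
    using that[of f] f by (simp add: smooth_fun_def)
qed

section \<open>The bracket of two pre-Hamiltonian lifts\<close>

lemma coPoisson_Jacobi_flat_sharp:
  assumes dual: "dual_almost_coPoisson_Jacobi A \<omega> \<Omega> E \<Lambda>"
    and "c \<in> A" and "p \<in> chart_dom c" and "\<alpha> \<in> range (flat \<Omega> c p)"
  shows "flat \<Omega> c p (sharp \<Lambda> c p \<alpha>) = \<alpha>"
proof -
  have bij: "bij_betw (flat \<Omega> c p) (range (sharp \<Lambda> c p)) (range (flat \<Omega> c p))"
    and inv: "the_inv_into (range (sharp \<Lambda> c p)) (flat \<Omega> c p) \<alpha> = sharp \<Lambda> c p \<alpha>"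
    using assms unfolding dual_almost_coPoisson_Jacobi_def by blast+
  show ?thesis
    using f_the_inv_into_f[of "flat \<Omega> c p" "range (sharp \<Lambda> c p)" \<alpha>] bij inv assms(4)
    by (simp add: bij_betw_def)
qed

theorem theorem2p4:
  fixes A :: "('m::{t2_space, second_countable_topology}, 'e::euclidean_space) chart set"
    and n :: nat
    and \<omega> :: "('m, 'e) one_form" and \<Omega> :: "('m, 'e) two_form"
    and E :: "('m, 'e) vector_field" and \<Lambda> :: "('m, 'e) two_vector_field"
    and f\<^sub>1 h\<^sub>1 f\<^sub>2 h\<^sub>2 :: "'m \<Rightarrow> real"
  assumes "smooth_manifold A" and "DIM('e) = 2 * n + 1"
    and "regular_almost_cosymplectic_contact A n \<omega> \<Omega>"
    and "dual_almost_coPoisson_Jacobi A \<omega> \<Omega> E \<Lambda>"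
    and "f\<^sub>1 \<in> conserved A E" and "smooth_fun A h\<^sub>1"
    and "f\<^sub>2 \<in> conserved A E" and "smooth_fun A h\<^sub>2"
  shows "\<exists>f h. f \<in> conserved A E \<and> smooth_fun A h \<and>
    (\<forall>c\<in>A. \<forall>p\<in>chart_dom c.
       lie_bracket (pre_hamiltonian_lift E \<Lambda> f\<^sub>1 h\<^sub>1) (pre_hamiltonian_lift E \<Lambda> f\<^sub>2 h\<^sub>2) c p =
       pre_hamiltonian_lift E \<Lambda> f h c p)"
proof -
  note A = assms(1)
  have \<omega>: "is_one_form A \<omega>" and \<Omega>: "is_two_form A \<Omega>"
    and closed: "\<And>c p u v w. c \<in> A \<Longrightarrow> p \<in> chart_dom c \<Longrightarrow> ext_deriv2 \<Omega> c p u v w = 0"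
    and volume: "\<And>c p. c \<in> A \<Longrightarrow> p \<in> chart_dom c \<Longrightarrow>
      \<exists>v. wedge 1 (2 * n) (\<lambda>v. \<omega> c p (v 0)) (two_form_power (\<Omega> c p) n) v \<noteq> 0"
    using assms(3) unfolding regular_almost_cosymplectic_contact_def by blast+
  have E: "is_vector_field A E" and \<Lambda>: "is_two_vector_field A \<Lambda>"
    and \<omega>E: "\<And>c p. c \<in> A \<Longrightarrow> p \<in> chart_dom c \<Longrightarrow> \<omega> c p (E c p) = 1"
    and \<Omega>E: "\<And>c p. c \<in> A \<Longrightarrow> p \<in> chart_dom c \<Longrightarrow> \<Omega> c p (E c p) = 0"
    and \<omega>_sharp: "\<And>c p. c \<in> A \<Longrightarrow> p \<in> chart_dom c \<Longrightarrow> sharp \<Lambda> c p (\<omega> c p) = 0"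
    using assms(4) unfolding dual_almost_coPoisson_Jacobi_def flat_def by blast+
  have skew: "\<And>c p u v. c \<in> A \<Longrightarrow> p \<in> chart_dom c \<Longrightarrow> \<Omega> c p u v = - \<Omega> c p v u"
    using \<Omega> unfolding is_two_form_def by blast
  have nondeg: "e = 0" if "c \<in> A" "p \<in> chart_dom c" "\<Omega> c p e = 0" "\<omega> c p e = 0" for c p e
    using volume[OF that(1,2)] volume_form_nondegenerate[OF assms(2) skew[OF that(1,2)] _ that(3,4)]
    by blast
  have flat_sharp: "\<Omega> c p (sharp \<Lambda> c p \<alpha>) = \<alpha>"
    if c: "c \<in> A" "p \<in> chart_dom c" and \<alpha>E: "\<alpha> (E c p) = 0" for c p and \<alpha> :: "'e \<Rightarrow>\<^sub>L real"
  proof -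
    obtain u where "\<alpha> = flat \<Omega> c p u"
      using range_two_form[OF nondeg[OF c] skew[OF c] \<omega>E[OF c] \<Omega>E[OF c] \<alpha>E]
      by (auto simp: flat_def)
    then have "\<alpha> \<in> range (flat \<Omega> c p)"
      by blast
    from coPoisson_Jacobi_flat_sharp[OF assms(4) c this] show ?thesis
      by (simp add: flat_def)
  qed
  \<comment> \<open>By skew symmetry of \<open>\<Lambda>\<close>, \<open>\<omega>\<close> vanishes on the image of \<open>\<sharp>\<close> because \<open>\<omega>\<^sup>\<sharp> = 0\<close>.\<close>
  have \<omega>_sharp_eq_0: "\<omega> c p (sharp \<Lambda> c p \<alpha>) = 0"
    if c: "c \<in> A" "p \<in> chart_dom c" for c p and \<alpha> :: "'e \<Rightarrow>\<^sub>L real"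
  proof -
    have "\<omega> c p (sharp \<Lambda> c p \<alpha>) = - \<Lambda> c p (\<omega> c p) \<alpha>"
      using \<Lambda> c unfolding apply_sharp is_two_vector_field_def by blast
    also have "\<dots> = - \<alpha> (sharp \<Lambda> c p (\<omega> c p))"
      by (simp add: apply_sharp)
    finally show ?thesis
      by (simp add: \<omega>_sharp[OF c])
  qed
  have lift: "\<Omega> c p (pre_hamiltonian_lift E \<Lambda> f h c p) = chart_deriv c f p"
    if "f \<in> conserved A E" "c \<in> A" "p \<in> chart_dom c" for f h c p
    using that flat_sharp[OF that(2,3), of "differential f c p"] \<Omega>E[OF that(2,3)]
    by (simp add: pre_hamiltonian_lift_def conserved_def blinfun.add_right blinfun.scaleR_right differential_def)
  have smooth: "smooth_fun A f\<^sub>1" "smooth_fun A f\<^sub>2"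
    using assms(5,7) by (simp_all add: conserved_def)
  define X Y where "X = pre_hamiltonian_lift E \<Lambda> f\<^sub>1 h\<^sub>1" and "Y = pre_hamiltonian_lift E \<Lambda> f\<^sub>2 h\<^sub>2"
  have X: "is_vector_field A X" and Y: "is_vector_field A Y"
    unfolding X_def Y_def using smooth assms(6,8)
    by (intro is_vector_field_pre_hamiltonian_lift[OF A E \<Lambda>]; simp)+
  \<comment> \<open>The function \<open>X \<cdot> f\<^sub>2\<close>, whose differential is the interior product of \<open>[X, Y]\<close> with \<open>\<Omega>\<close>.\<close>
  obtain f where f: "smooth_fun A f"
    and f_eq: "\<And>c p. c \<in> A \<Longrightarrow> p \<in> chart_dom c \<Longrightarrow> f p = differential f\<^sub>2 c p (X c p)"
    using contraction[OF A is_one_form_differential[OF A smooth(2)] X] by blast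
  \<comment> \<open>Applying \<open>\<omega>\<close> to \<open>[X, Y] = df\<^sup>\<sharp> + h E\<close> forces this choice of \<open>h\<close>.\<close>
  obtain h where h: "smooth_fun A h"
    and h_eq: "\<And>c p. c \<in> A \<Longrightarrow> p \<in> chart_dom c \<Longrightarrow> h p = \<omega> c p (lie_bracket X Y c p)"
    using contraction[OF A \<omega> is_vector_field_lie_bracket[OF A X Y]] by blast
  have bracket: "\<Omega> c p (lie_bracket X Y c p) = differential f c p"
    if c: "c \<in> A" "p \<in> chart_dom c" for c p
  proof -
    note chart = smooth_manifold_chart[OF A c(1)]
    have smooth_c: "smooth_in c (\<Omega> c)" "smooth_in c f\<^sub>1" "smooth_in c f\<^sub>2"
      using \<Omega> smooth c by (auto simp: is_two_form_def smooth_fun_def)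
    have "\<Omega> c p (lie_bracket X Y c p) = chart_deriv c (\<lambda>q. chart_deriv c f\<^sub>2 q (X c q)) p"
      unfolding lie_bracket_def
    proof (rule interior_product_bracket[OF chart c(2) smooth_c(1) vector_field_smooth[OF X c(1)]
          vector_field_smooth[OF Y c(1)] smooth_c(2,3) skew[OF c(1)]])
      show "chart_deriv c (\<lambda>q. \<Omega> c q v w) p u + chart_deriv c (\<lambda>q. \<Omega> c q w u) p v
        + chart_deriv c (\<lambda>q. \<Omega> c q u v) p w = 0" for u v w
        using closed[OF c] by (simp add: ext_deriv2_def)
    qed (simp_all add: X_def Y_def lift assms(5,7) c(1))
    also have "\<dots> = chart_deriv c f p"
    proof (rule chart_deriv_cong[OF chart _ order_refl c(2)])
      show "open (chart_dom c)"
        using chart by (simp add: is_chart_def)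
      show "chart_deriv c f\<^sub>2 q (X c q) = f q" if "q \<in> chart_dom c" for q
        using f_eq[OF c(1) that] by (simp add: differential_def)
      show "in_chart c f differentiable at (coord c p)"
        using f c by (intro smooth_in_differentiable) (simp_all add: smooth_fun_def)
    qed
    finally show ?thesis
      by (simp add: differential_def)
  qed
  have "f \<in> conserved A E"
    unfolding conserved_def
  proof (intro CollectI conjI ballI f)
    fix c p assume c: "c \<in> A" "p \<in> chart_dom c"
    show "differential f c p (E c p) = 0"
      using skew[OF c, of "lie_bracket X Y c p" "E c p"] by (simp add: bracket[OF c] \<Omega>E[OF c])
  qed
  moreover have "lie_bracket X Y c p = pre_hamiltonian_lift E \<Lambda> f h c p"
    if c: "c \<in> A" "p \<in> chart_dom c" for c p
  proof -
    let ?Z = "lie_bracket X Y c p" and ?H = "sharp \<Lambda> c p (differential f c p)"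
    have "\<Omega> c p (?Z - ?H) = 0"
      using flat_sharp[OF c] \<open>f \<in> conserved A E\<close> c
      by (simp add: blinfun.diff_right bracket[OF c] conserved_def)
    from kernel_two_form[OF nondeg[OF c] \<omega>E[OF c] \<Omega>E[OF c] this]
    have "?Z - ?H = h p *\<^sub>R E c p"
      by (simp add: blinfun.diff_right \<omega>_sharp_eq_0[OF c] h_eq[OF c])
    then show ?thesis
      by (simp add: pre_hamiltonian_lift_def algebra_simps)
  qed
  ultimately show ?thesis
    using h unfolding X_def Y_def by blast
qed

end
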